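(* In any convex resource theory, with free sets $\mathcal F$ on the input space and $\mathcal F'$ on the output space, for states $\rho$ (input) and $\rho'$ (output) there exists a resource--non-generating probabilistic transformation $\rho\to\rho'$ if any of the following holds: (i) $\infty>\Omega_{\mathcal F}(\rho)\ge\Omega^{\mathcal F'}_{\mathcal F'}(\rho')$; (ii) $\Omega_{\mathcal F}(\rho)=\infty$ and $R^{\mathcal F'}_{\mathcal F'}(\rho')<\infty$; (iii) $R_{\mathcal F}(\rho)=\infty$.
   Context: Finite dimensions; $A\le B$ means $B-A\ge0$. Each space carries a closed convex set $\mathcal F$ of free density operators; $\mathrm{cone}(\mathcal F)=\{\lambda\sigma:\lambda\ge0,\sigma\in\mathcal F\}$, $A\le_{\mathcal F}B$ means $B-A\in\mathrm{cone}(\mathcal F)$. $R_{\max}(X\|Y)=\inf\{\lambda:X\le\lambda Y\}$, $R^{\mathcal F}_{\max}(X\|Y)=\inf\{\lambda:X\le_{\mathcal F}\lambda Y\}$, $\inf\emptyset=\infty$. $R_{\mathcal F}(\rho)=\min_{\sigma\in\mathcal F}R_{\max}(\rho\|\sigma)$, $R^{\mathcal F}_{\mathcal F}(\rho)=\min_{\sigma\in\mathcal F}R^{\mathcal F}_{\max}(\rho\|\sigma)$, $\Omega_{\mathcal F}(\rho)=\inf_{\sigma\in\mathcal F}R_{\max}(\rho\|\sigma)R_{\max}(\sigma\|\rho)$, $\Omega^{\mathcal F}_{\mathcal F}(\rho)=\inf_{\sigma\in\mathcal F}R^{\mathcal F}_{\max}(\rho\|\sigma)R_{\max}(\sigma\|\rho)$.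 $\mathbb O$ is the set of completely positive trace-non-increasing maps $\mathcal E$ such that for every $\sigma\in\mathcal F$ there exist $\sigma'\in\mathcal F'$ and $p\in[0,1]$ with $\mathcal E(\sigma)=p\sigma'$. A probabilistic transformation $\rho\to\rho'$ exists iff $\rho'$ lies in the closure of $\{\mathcal E(\rho)/\mathrm{Tr}\,\mathcal E(\rho):\mathcal E\in\mathbb O,\ \mathrm{Tr}\,\mathcal E(\rho)>0\}$. *)

theory Defs
  imports "Jordan_Normal_Form.Matrix" "HOL-Library.Extended_Real"
begin

text \<open>Operators on a d-dimensional Hilbert space are d x d complex matrices
  (carrier_mat d d).\<close>

definition mtrace :: "complex mat \<Rightarrow> complex" where
  "mtrace A = (\<Sum>i<dim_row A. A $$ (i, i))"

definition psd :: "nat \<Rightarrow> complex mat \<Rightarrow> bool" where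
  "psd d A \<longleftrightarrow> A \<in> carrier_mat d d
     \<and> (\<forall>i<d. \<forall>j<d. A $$ (i, j) = cnj (A $$ (j, i)))
     \<and> (\<forall>v :: nat \<Rightarrow> complex.
          0 \<le> Re (\<Sum>i<d. \<Sum>j<d. cnj (v i) * A $$ (i, j) * v j))"

definition loewner_le :: "nat \<Rightarrow> complex mat \<Rightarrow> complex mat \<Rightarrow> bool" where
  "loewner_le d A B \<longleftrightarrow> A \<in> carrier_mat d d \<and> B \<in> carrier_mat d d \<and> psd d (B - A)"

definition density :: "nat \<Rightarrow> complex mat \<Rightarrow> bool" where
  "density d \<rho> \<longleftrightarrow> psd d \<rho> \<and> mtrace \<rho> = 1"

text \<open>Closedness (standard topology of the finite-dimensional space, i.e. entrywise
  convergence) and convexity of a set of d x d matrices.\<close>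
definition mat_closed :: "nat \<Rightarrow> complex mat set \<Rightarrow> bool" where
  "mat_closed d S \<longleftrightarrow> (\<forall>X A. (\<forall>k. X k \<in> S) \<longrightarrow> A \<in> carrier_mat d d \<longrightarrow>
      (\<forall>i<d. \<forall>j<d. (\<lambda>k. X k $$ (i, j)) \<longlonglongrightarrow> A $$ (i, j)) \<longrightarrow> A \<in> S)"

definition mat_convex :: "complex mat set \<Rightarrow> bool" where
  "mat_convex S \<longleftrightarrow> (\<forall>A\<in>S. \<forall>B\<in>S. \<forall>t::real. 0 \<le> t \<longrightarrow> t \<le> 1 \<longrightarrow>
      complex_of_real t \<cdot>\<^sub>m A + complex_of_real (1 - t) \<cdot>\<^sub>m B \<in> S)"

definition free_set :: "nat \<Rightarrow> complex mat set \<Rightarrow> bool" where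
  "free_set d F \<longleftrightarrow> F \<noteq> {} \<and> (\<forall>\<sigma>\<in>F. density d \<sigma>) \<and> mat_closed d F \<and> mat_convex F"

definition cone :: "complex mat set \<Rightarrow> complex mat set" where
  "cone F = {complex_of_real l \<cdot>\<^sub>m \<sigma> | l \<sigma>. 0 \<le> l \<and> \<sigma> \<in> F}"

definition free_le :: "nat \<Rightarrow> complex mat set \<Rightarrow> complex mat \<Rightarrow> complex mat \<Rightarrow> bool" where
  "free_le d F A B \<longleftrightarrow> A \<in> carrier_mat d d \<and> B \<in> carrier_mat d d \<and> B - A \<in> cone F"

text \<open>Max-relative quantities, with inf of the empty set = \<infinity>.\<close>
definition Rmax :: "nat \<Rightarrow> complex mat \<Rightarrow> complex mat \<Rightarrow> ereal" where
  "Rmax d X Y = Inf {ereal l | l. loewner_le d X (complex_of_real l \<cdot>\<^sub>m Y)}"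

definition RmaxF :: "nat \<Rightarrow> complex mat set \<Rightarrow> complex mat \<Rightarrow> complex mat \<Rightarrow> ereal" where
  "RmaxF d F X Y = Inf {ereal l | l. free_le d F X (complex_of_real l \<cdot>\<^sub>m Y)}"

definition RF :: "nat \<Rightarrow> complex mat set \<Rightarrow> complex mat \<Rightarrow> ereal" where
  "RF d F \<rho> = (INF \<sigma>\<in>F. Rmax d \<rho> \<sigma>)"

definition RFF :: "nat \<Rightarrow> complex mat set \<Rightarrow> complex mat \<Rightarrow> ereal" where
  "RFF d F \<rho> = (INF \<sigma>\<in>F. RmaxF d F \<rho> \<sigma>)"

definition OmegaF :: "nat \<Rightarrow> complex mat set \<Rightarrow> complex mat \<Rightarrow> ereal" where
  "OmegaF d F \<rho> = (INF \<sigma>\<in>F. Rmax d \<rho> \<sigma> * Rmax d \<sigma> \<rho>)"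

definition OmegaFF :: "nat \<Rightarrow> complex mat set \<Rightarrow> complex mat \<Rightarrow> ereal" where
  "OmegaFF d F \<rho> = (INF \<sigma>\<in>F. RmaxF d F \<rho> \<sigma> * Rmax d \<sigma> \<rho>)"

definition lin_map :: "nat \<Rightarrow> nat \<Rightarrow> (complex mat \<Rightarrow> complex mat) \<Rightarrow> bool" where
  "lin_map d d' E \<longleftrightarrow>
     (\<forall>A\<in>carrier_mat d d. E A \<in> carrier_mat d' d')
   \<and> (\<forall>A\<in>carrier_mat d d. \<forall>B\<in>carrier_mat d d. E (A + B) = E A + E B)
   \<and> (\<forall>A\<in>carrier_mat d d. \<forall>c. E (c \<cdot>\<^sub>m A) = c \<cdot>\<^sub>m E A)"

text \<open>id_k \<otimes> E acting on (k*d) x (k*d) matrices, viewed as k x k block matrices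
  with d x d blocks.\<close>
definition block :: "nat \<Rightarrow> complex mat \<Rightarrow> nat \<Rightarrow> nat \<Rightarrow> complex mat" where
  "block d X a b = mat d d (\<lambda>(r, s). X $$ (a * d + r, b * d + s))"

definition ampl :: "nat \<Rightarrow> nat \<Rightarrow> nat \<Rightarrow> (complex mat \<Rightarrow> complex mat) \<Rightarrow> complex mat \<Rightarrow> complex mat" where
  "ampl k d d' E X = mat (k * d') (k * d')
     (\<lambda>(i, j). E (block d X (i div d') (j div d')) $$ (i mod d', j mod d'))"

definition completely_positive :: "nat \<Rightarrow> nat \<Rightarrow> (complex mat \<Rightarrow> complex mat) \<Rightarrow> bool" where
  "completely_positive d d' E \<longleftrightarrow> lin_map d d' E \<and>
     (\<forall>k. \<forall>X. psd (k * d) X \<longrightarrow> psd (k * d') (ampl k d d' E X))"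

definition trace_nonincreasing :: "nat \<Rightarrow> (complex mat \<Rightarrow> complex mat) \<Rightarrow> bool" where
  "trace_nonincreasing d E \<longleftrightarrow> (\<forall>X. psd d X \<longrightarrow> Re (mtrace (E X)) \<le> Re (mtrace X))"

definition free_ops :: "nat \<Rightarrow> complex mat set \<Rightarrow> nat \<Rightarrow> complex mat set \<Rightarrow>
    (complex mat \<Rightarrow> complex mat) set" where
  "free_ops d F d' F' = {E. completely_positive d d' E \<and> trace_nonincreasing d E \<and>
     (\<forall>\<sigma>\<in>F. \<exists>\<sigma>'\<in>F'. \<exists>p::real. 0 \<le> p \<and> p \<le> 1 \<and> E \<sigma> = complex_of_real p \<cdot>\<^sub>m \<sigma>')}"

text \<open>\<rho>' lies in the closure of the set of normalized outputs E(\<rho>)/Tr E(\<rho>),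
  E \<in> \<bbbO>, Tr E(\<rho>) > 0 (closure in the standard topology, written entrywise).\<close>
definition prob_transformable :: "nat \<Rightarrow> complex mat set \<Rightarrow> nat \<Rightarrow> complex mat set \<Rightarrow>
    complex mat \<Rightarrow> complex mat \<Rightarrow> bool" where
  "prob_transformable d F d' F' \<rho> \<rho>' \<longleftrightarrow>
     (\<forall>\<epsilon>>0. \<exists>E\<in>free_ops d F d' F'. 0 < Re (mtrace (E \<rho>)) \<and>
        (\<forall>i<d'. \<forall>j<d'. cmod ((E \<rho>) $$ (i, j) / mtrace (E \<rho>) - \<rho>' $$ (i, j)) < \<epsilon>))"

end

theory Submission
  imports "HOL-Analysis.Function_Metric" "HOL-Analysis.Topology_Euclidean_Space" Defs
begin

text \<open>All transformations are rescaled measure-and-prepare maps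
  \<open>E(X) = tr (A X) P + tr (B X) Q\<close>. Consider the cone of pairs \<open>(x, y)\<close> with
  \<open>x \<le> S \<le> y\<close> for some \<open>S \<in> cone F\<close> (closed, since the trace of \<open>y\<close> bounds \<open>S\<close>); conic
  separation of \<open>(\<rho>, t \<rho>)\<close> gives, for every \<open>t < \<Omega>\<^sub>F(\<rho>)\<close>, positive \<open>A\<close>, \<open>B\<close> with
  \<open>tr (A \<sigma>) \<le> tr (B \<sigma>)\<close> on \<open>F\<close> and \<open>tr (A \<rho>) = t tr (B \<rho>) > 0\<close>. Then \<open>E\<close> is free as soon as
  \<open>Q\<close> and \<open>P + Q\<close> lie in \<open>cone F'\<close>, and \<open>E(\<rho>)\<close> is proportional to \<open>t P + Q\<close>.
  If \<open>\<rho>' \<le> l \<sigma>'\<close> in the order of \<open>F'\<close> and \<open>\<sigma>' \<le> m \<rho>'\<close>, take \<open>P = \<rho>' - \<sigma>' / m\<close> and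
  \<open>Q = l \<sigma>' - \<rho>'\<close>: the output is \<open>(t - 1) \<rho>' + (l - t / m) \<sigma>'\<close>, which is close to \<open>\<rho>'\<close> when
  \<open>t\<close> is close to \<open>l m\<close> and away from 1. If \<open>\<Omega>\<^sub>F(\<rho>) = \<infinity>\<close>, take \<open>P = \<rho>'\<close> and let \<open>t\<close> grow.
  If \<open>R\<^sub>F(\<rho>) = \<infinity>\<close>, some vector is annihilated by all free states but not by \<open>\<rho>\<close>; measuring it
  and preparing \<open>\<rho>'\<close> sends every free state to 0.\<close>

section \<open>Closest points and separation of closed cones\<close>

text \<open>Tychonoff: a product of closed discs over \<open>I\<close> and of the singleton 0
  elsewhere. Vectors and matrices are modelled throughout as functions supported in a fixed index
  set, so that compactness is available although the dimension is a variable and not a type.\<close>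

lemma compact_supported_box:
  "compact {f :: 'i \<Rightarrow> complex. (\<forall>i\<in>I. norm (f i) \<le> r) \<and> (\<forall>i. i \<notin> I \<longrightarrow> f i = 0)}"
proof -
  let ?S = "\<lambda>i. if i \<in> I then cball (0::complex) r else {0}"
  have "{f :: 'i \<Rightarrow> complex. (\<forall>i\<in>I. norm (f i) \<le> r) \<and> (\<forall>i. i \<notin> I \<longrightarrow> f i = 0)} = Pi\<^sub>E UNIV ?S"
    by (auto simp: PiE_iff dist_norm split: if_splits)
  moreover have "compactin (product_topology (\<lambda>i. euclidean) UNIV) (Pi\<^sub>E UNIV ?S)"
    by (subst compactin_PiE) (auto simp: compactin_euclidean_iff)
  ultimately show ?thesis
    by (simp add: euclidean_product_topology compactin_euclidean_iff)
qed

text \<open>The real part of the Hermitian inner product, since projection and separation are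
  statements over the reals.\<close>

definition fdot :: "'i set \<Rightarrow> ('i \<Rightarrow> complex) \<Rightarrow> ('i \<Rightarrow> complex) \<Rightarrow> real" where
  "fdot I f g = (\<Sum>i\<in>I. inner (f i) (g i))"

lemma continuous_on_coordinate [continuous_intros]:
  "continuous_on S (\<lambda>f :: 'i \<Rightarrow> 'b::topological_space. f i)"
  by (rule continuous_on_subset[OF continuous_on_product_coordinates]) simp

lemma fdot_diff_left: "fdot I (\<lambda>i. f i - g i) h = fdot I f h - fdot I g h"
  by (simp add: fdot_def inner_diff_left sum_subtractf)

lemma fdot_diff_right: "fdot I h (\<lambda>i. f i - g i) = fdot I h f - fdot I h g"
  by (simp add: fdot_def inner_diff_right sum_subtractf)

lemma fdot_scaleR_right: "fdot I h (\<lambda>i. t *\<^sub>R f i) = t * fdot I h f"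
  by (simp add: fdot_def sum_distrib_left)

lemma fdot_self_nonneg: "0 \<le> fdot I f f"
  by (simp add: fdot_def sum_nonneg)

lemma fdot_self_eq_0_iff: "finite I \<Longrightarrow> fdot I f f = 0 \<longleftrightarrow> (\<forall>i\<in>I. f i = 0)"
  by (simp add: fdot_def sum_nonneg_eq_0_iff)

lemma norm_coord_le_fdot:
  assumes "finite I" "i \<in> I"
  shows "norm (f i) \<le> sqrt (fdot I f f)"
proof -
  have "(norm (f i))\<^sup>2 \<le> fdot I f f"
    unfolding fdot_def power2_norm_eq_inner using assms by (intro member_le_sum) auto
  then show ?thesis by (simp add: real_le_rsqrt)
qed

text \<open>The squared distance \<open>D\<close> attains its minimum on the part of
  \<open>C\<close> no farther from \<open>x\<close> than some chosen point, which is compact. The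
  variational inequality is the first-order condition at the minimiser \<open>c\<close> along the
  segment from \<open>c\<close> to \<open>z\<close>.\<close>

lemma closest_point_supported:
  fixes C :: "('i \<Rightarrow> complex) set"
  assumes I: "finite I" and C: "closed C" "C \<noteq> {}"
    and supp: "\<And>f i. f \<in> C \<Longrightarrow> i \<notin> I \<Longrightarrow> f i = 0"
    and conv: "\<And>f g t. f \<in> C \<Longrightarrow> g \<in> C \<Longrightarrow> 0 \<le> t \<Longrightarrow> t \<le> 1 \<Longrightarrow> (\<lambda>i. f i + t *\<^sub>R (g i - f i)) \<in> C"
  obtains c where "c \<in> C" "\<And>z. z \<in> C \<Longrightarrow> fdot I (\<lambda>i. x i - c i) (\<lambda>i. z i - c i) \<le> 0"
proof -
  define D where "D f = fdot I (\<lambda>i. x i - f i) (\<lambda>i. x i - f i)" for f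
  obtain c0 where c0: "c0 \<in> C" using C by auto
  \<comment> \<open>A coordinate of \<open>f\<close> is at most that of \<open>x\<close> plus the
    distance from \<open>x\<close> to \<open>f\<close>, which on \<open>?K\<close> is at most the
    distance to \<open>c0\<close>.\<close>
  define R where "R = (\<Sum>i\<in>I. norm (x i)) + sqrt (D c0)"
  let ?K = "C \<inter> {f. D f \<le> D c0}"
  have cD: "continuous_on S D" for S
    unfolding D_def fdot_def by (intro continuous_intros)
  have "norm (f i) \<le> R" if f: "f \<in> ?K" and i: "i \<in> I" for f i
  proof -
    have "norm (x i - f i) \<le> sqrt (D f)"
      unfolding D_def using norm_coord_le_fdot[OF I i, of "\<lambda>i. x i - f i"] .
    moreover have "sqrt (D f) \<le> sqrt (D c0)" using f by simp
    moreover have "norm (x i) \<le> (\<Sum>i\<in>I. norm (x i))"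
      using I i by (intro member_le_sum) auto
    moreover have "norm (f i) \<le> norm (x i) + norm (x i - f i)"
      by (metis norm_minus_commute norm_triangle_sub)
    ultimately show ?thesis unfolding R_def by linarith
  qed
  then have sub: "?K \<subseteq> {f. (\<forall>i\<in>I. norm (f i) \<le> R) \<and> (\<forall>i. i \<notin> I \<longrightarrow> f i = 0)}"
    using supp by auto
  have "closed {f. D f \<le> D c0}"
    by (rule closed_Collect_le[OF cD continuous_on_const])
  then have "closed ?K" using C by (intro closed_Int)
  then have "compact ({f. (\<forall>i\<in>I. norm (f i) \<le> R) \<and> (\<forall>i. i \<notin> I \<longrightarrow> f i = 0)} \<inter> ?K)"
    by (rule compact_Int_closed[OF compact_supported_box])
  then have "compact ?K"
    by (simp only: Int_absorb1[OF sub])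
  moreover have "?K \<noteq> {}" using c0 by auto
  ultimately have "\<exists>c\<in>?K. \<forall>f\<in>?K. D c \<le> D f"
    by (rule continuous_attains_inf[OF _ _ cD])
  then obtain c where c: "c \<in> ?K" "\<forall>f\<in>?K. D c \<le> D f" ..
  have min: "D c \<le> D f" if "f \<in> C" for f
    using c that by (cases "D f \<le> D c0") auto
  show thesis
  proof (rule that)
    show "c \<in> C" using c by simp
    fix z assume z: "z \<in> C"
    define p where "p = fdot I (\<lambda>i. x i - c i) (\<lambda>i. z i - c i)"
    define k where "k = fdot I (\<lambda>i. z i - c i) (\<lambda>i. z i - c i)"
    have exp: "D (\<lambda>i. c i + t *\<^sub>R (z i - c i)) = D c - 2 * t * p + t\<^sup>2 * k" for t
    proof -
      have "inner (a - (b + t *\<^sub>R (e - b))) (a - (b + t *\<^sub>R (e - b)))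
        = inner (a - b) (a - b) - 2 * t * inner (a - b) (e - b) + t\<^sup>2 * inner (e - b) (e - b)"
        for a b e :: complex
        by (simp add: inner_complex_def power2_eq_square algebra_simps)
      then show ?thesis
        by (simp add: D_def p_def k_def fdot_def sum.distrib sum_subtractf sum_distrib_left)
    qed
    show "p \<le> 0"
    proof (rule ccontr)
      assume "\<not> p \<le> 0"
      then have p: "p > 0" by simp
      have k: "k \<ge> 0" unfolding k_def by (rule fdot_self_nonneg)
      \<comment> \<open>A step short enough for the quadratic term to lose against the linear gain:
        \<open>t * k \<le> p\<close>, whereas minimality demands
        \<open>2 * p \<le> t * k\<close>.\<close>
      define t where "t = p / (p + k)"
      have t: "0 < t" "t \<le> 1" using p k by (auto simp: t_def)
      have "t * k \<le> p" using p k by (simp add: t_def field_simps)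
      have "D c \<le> D c - 2 * t * p + t\<^sup>2 * k"
        using min[OF conv[OF \<open>c \<in> C\<close> z, of t]] t exp[of t] by simp
      then have "t * (2 * p) \<le> t * (t * k)" by (simp add: power2_eq_square algebra_simps)
      then have "2 * p \<le> t * k" using t by simp
      then show False using \<open>t * k \<le> p\<close> p by linarith
    qed
  qed
qed

text \<open>The separating vector is \<open>c - x\<close>, with \<open>c\<close> the projection of
  \<open>x\<close> onto \<open>C\<close>. In a cone the variational inequality can be tested at
  \<open>c + z\<close> and at 0; the first makes \<open>x - c\<close> nonpositive on
  \<open>C\<close>, the second makes its product with \<open>c\<close> nonnegative, so its product
  with \<open>x\<close> is at least the squared norm of \<open>x - c\<close>.\<close>

lemma closed_cone_separation:
  fixes C :: "('i \<Rightarrow> complex) set"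
  assumes I: "finite I" and C: "closed C"  "(\<lambda>_. 0) \<in> C"
    and supp: "\<And>f i. f \<in> C \<Longrightarrow> i \<notin> I \<Longrightarrow> f i = 0"
    and add: "\<And>f g. f \<in> C \<Longrightarrow> g \<in> C \<Longrightarrow> (\<lambda>i. f i + g i) \<in> C"
    and scale: "\<And>f t. f \<in> C \<Longrightarrow> 0 \<le> t \<Longrightarrow> (\<lambda>i. t *\<^sub>R f i) \<in> C"
    and x: "x \<notin> C" "\<And>i. i \<notin> I \<Longrightarrow> x i = 0"
  obtains y where "\<And>z. z \<in> C \<Longrightarrow> 0 \<le> fdot I y z" "fdot I y x < 0"
proof -
  have conv: "(\<lambda>i. f i + t *\<^sub>R (g i - f i)) \<in> C"
    if "f \<in> C" "g \<in> C" "0 \<le> t" "t \<le> 1" for f g t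
    using add[OF scale[OF that(1), of "1 - t"] scale[OF that(2,3)]] that(4)
    by (simp add: algebra_simps)
  obtain c where c: "c \<in> C" "\<And>z. z \<in> C \<Longrightarrow> fdot I (\<lambda>i. x i - c i) (\<lambda>i. z i - c i) \<le> 0"
    by (rule closest_point_supported[of I C x]) (use assms conv in auto)
  have z: "fdot I (\<lambda>i. x i - c i) z \<le> 0" if "z \<in> C" for z
    using c(2)[OF add[OF c(1) that]] by simp
  have "fdot I (\<lambda>i. x i - c i) c \<ge> 0"
    using c(2)[OF C(2)] by (simp add: fdot_def sum_negf)
  moreover have "fdot I (\<lambda>i. x i - c i) (\<lambda>i. x i - c i) > 0"
  proof -
    have "\<exists>i\<in>I. x i - c i \<noteq> 0"
      using c(1) x supp by (metis eq_iff_diff_eq_0 ext)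
    then show ?thesis
      using fdot_self_eq_0_iff[OF I] fdot_self_nonneg by (metis order_le_less)
  qed
  ultimately have "fdot I (\<lambda>i. x i - c i) x > 0"
    by (simp add: fdot_diff_right)
  then have "fdot I (\<lambda>i. c i - x i) x < 0"
    by (simp add: fdot_diff_left)
  moreover have "0 \<le> fdot I (\<lambda>i. c i - x i) y" if "y \<in> C" for y
    using z[OF that] by (simp add: fdot_diff_left)
  ultimately show thesis
    using that by blast
qed

section \<open>Positive semidefinite matrices\<close>

definition bform :: "nat \<Rightarrow> (nat \<times> nat \<Rightarrow> complex) \<Rightarrow> (nat \<Rightarrow> complex) \<Rightarrow> (nat \<Rightarrow> complex) \<Rightarrow> complex" where
  "bform d f u v = (\<Sum>i<d. \<Sum>j<d. cnj (u i) * f (i, j) * v j)"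

text \<open>Functions on index pairs replace matrices, so that sums, differences and limits are
  formed pointwise without dimension conditions. Only values at indices below \<open>d\<close>
  matter (\<open>psdf_cong\<close>).\<close>

definition psdf :: "nat \<Rightarrow> (nat \<times> nat \<Rightarrow> complex) \<Rightarrow> bool" where
  "psdf d f \<longleftrightarrow> (\<forall>i<d. \<forall>j<d. f (i, j) = cnj (f (j, i))) \<and> (\<forall>v. 0 \<le> Re (bform d f v v))"

lemma psd_iff_psdf: "psd d A \<longleftrightarrow> A \<in> carrier_mat d d \<and> psdf d (($$) A)"
  by (simp add: psd_def psdf_def bform_def)

lemma psdf_nonneg: "psdf d f \<Longrightarrow> 0 \<le> Re (bform d f v v)"
  by (simp add: psdf_def)

lemma psdf_cnj: "psdf d f \<Longrightarrow> i < d \<Longrightarrow> j < d \<Longrightarrow> cnj (f (i, j)) = f (j, i)"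
  unfolding psdf_def by metis

lemma psdfI:
  assumes "\<And>i j. i < d \<Longrightarrow> j < d \<Longrightarrow> cnj (f (i, j)) = f (j, i)" "\<And>v. 0 \<le> Re (bform d f v v)"
  shows "psdf d f"
  using assms unfolding psdf_def by metis

lemma bform_add_left: "bform d f (\<lambda>i. u i + w i) v = bform d f u v + bform d f w v"
  by (simp add: bform_def sum.distrib algebra_simps)

lemma bform_add_right: "bform d f u (\<lambda>i. v i + w i) = bform d f u v + bform d f u w"
  by (simp add: bform_def sum.distrib algebra_simps)

lemma bform_scale_left: "bform d f (\<lambda>i. c * u i) v = cnj c * bform d f u v"
  by (simp add: bform_def sum_distrib_left algebra_simps)

lemma bform_scale_right: "bform d f u (\<lambda>i. c * v i) = c * bform d f u v"
  by (simp add: bform_def sum_distrib_left algebra_simps)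

lemma bform_add_mat: "bform d (\<lambda>x. f x + g x) u v = bform d f u v + bform d g u v"
  by (simp add: bform_def sum.distrib algebra_simps)

lemma bform_diff_mat: "bform d (\<lambda>x. f x - g x) u v = bform d f u v - bform d g u v"
  by (simp add: bform_def sum_subtractf algebra_simps)

lemma bform_scale_mat: "bform d (\<lambda>x. c * f x) u v = c * bform d f u v"
  by (simp add: bform_def sum_distrib_left algebra_simps)

lemma bform_cong:
  "(\<And>i j. i < d \<Longrightarrow> j < d \<Longrightarrow> f (i, j) = g (i, j)) \<Longrightarrow> bform d f u v = bform d g u v"
  unfolding bform_def by (intro sum.cong) auto

lemma psdf_cong:
  "(\<And>i j. i < d \<Longrightarrow> j < d \<Longrightarrow> f (i, j) = g (i, j)) \<Longrightarrow> psdf d f \<longleftrightarrow> psdf d g"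
  using bform_cong[of d f g] psdf_cnj[of d] psdf_nonneg[of d] by (metis psdfI)

lemma psdf_add: "psdf d f \<Longrightarrow> psdf d g \<Longrightarrow> psdf d (\<lambda>x. f x + g x)"
  by (rule psdfI) (auto simp: psdf_cnj psdf_nonneg bform_add_mat)

lemma psdf_scale: "psdf d f \<Longrightarrow> 0 \<le> c \<Longrightarrow> psdf d (\<lambda>x. complex_of_real c * f x)"
  by (rule psdfI) (auto simp: psdf_cnj psdf_nonneg bform_scale_mat)

lemma psdf_rank_one: "psdf d (\<lambda>(i, j). u i * cnj (u j))"
proof -
  have "bform d (\<lambda>(i, j). u i * cnj (u j)) v v = (\<Sum>i<d. cnj (v i) * u i) * cnj (\<Sum>i<d. cnj (v i) * u i)" for v
    by (simp add: bform_def sum_product cnj_sum algebra_simps)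
  moreover have "0 \<le> Re (z * cnj z)" for z :: complex by simp
  ultimately show ?thesis unfolding psdf_def by (simp only: prod.case) simp
qed

section \<open>Unit vectors and bounds on matrix entries\<close>

abbreviation unit_fun :: "nat \<Rightarrow> nat \<Rightarrow> complex" where
  "unit_fun k \<equiv> (\<lambda>i. if i = k then 1 else 0)"

lemma bform_unit_right: "k < d \<Longrightarrow> bform d f u (unit_fun k) = (\<Sum>i<d. cnj (u i) * f (i, k))"
  by (simp add: bform_def if_distrib[where f="\<lambda>x. _ * x"] cong: if_cong)

lemma bform_unit_left: "k < d \<Longrightarrow> bform d f (unit_fun k) u = (\<Sum>i<d. f (k, i) * u i)"
proof -
  assume "k < d"
  have "bform d f (unit_fun k) u = (\<Sum>i<d. if i = k then \<Sum>j<d. f (i, j) * u j else 0)"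
    unfolding bform_def by (intro sum.cong) auto
  then show ?thesis using \<open>k < d\<close> by simp
qed

lemma bform_unit_unit: "k < d \<Longrightarrow> l < d \<Longrightarrow> bform d f (unit_fun k) (unit_fun l) = f (k, l)"
  by (simp add: bform_unit_left if_distrib[where f="\<lambda>x. _ * x"] cong: if_cong)

lemma cnj_bform: "psdf d f \<Longrightarrow> cnj (bform d f u v) = bform d f v u"
  unfolding bform_def cnj_sum
  by (subst sum.swap, intro sum.cong) (auto simp: psdf_cnj algebra_simps)

lemma bform_self_real: "psdf d f \<Longrightarrow> bform d f v v = complex_of_real (Re (bform d f v v))"
  using cnj_bform[of d f v v] by (simp add: complex_eq_iff)

lemma psdf_diag:
  assumes "psdf d f" "k < d"
  shows "f (k, k) = complex_of_real (Re (f (k, k)))" "0 \<le> Re (f (k, k))"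
proof -
  have "bform d f (unit_fun k) (unit_fun k) = f (k, k)"
    using assms(2) by (rule bform_unit_unit) fact
  then show "f (k, k) = complex_of_real (Re (f (k, k)))" "0 \<le> Re (f (k, k))"
    using assms bform_self_real[OF assms(1), of "unit_fun k"] psdf_nonneg[OF assms(1), of "unit_fun k"] by auto
qed

text \<open>This expansion serves twice: with a phase \<open>z\<close> it bounds off-diagonal
  entries, with the minimising \<open>z\<close> it yields the Schur complement.\<close>

lemma bform_add_scaled_unit:
  assumes f: "psdf d f" and k: "k < d"
  shows "bform d f (\<lambda>i. v i + z * unit_fun k i) (\<lambda>i. v i + z * unit_fun k i)
    = bform d f v v + z * bform d f v (unit_fun k) + cnj (z * bform d f v (unit_fun k))
      + z * cnj z * f (k, k)"
proof -
  have "bform d f (\<lambda>i. v i + z * unit_fun k i) (\<lambda>i. v i + z * unit_fun k i)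
    = bform d f v v + z * bform d f v (unit_fun k) + cnj z * bform d f (unit_fun k) v
      + z * cnj z * bform d f (unit_fun k) (unit_fun k)"
    by (simp only: bform_add_left bform_add_right bform_scale_left bform_scale_right) (simp add: algebra_simps)
  moreover have "bform d f (unit_fun k) v = cnj (bform d f v (unit_fun k))"
    using cnj_bform[OF f] by simp
  ultimately show ?thesis
    using bform_unit_unit[OF k k, of f] by (simp add: algebra_simps)
qed

text \<open>The form is evaluated at the sum of the \<open>i\<close>-th unit vector and
  \<open>z\<close> times the \<open>j\<close>-th, where the phase \<open>z\<close> turns
  \<open>f (i, j)\<close> into minus its modulus. In particular a positive matrix with zero diagonal
  vanishes.\<close>

lemma psdf_entry_bound:
  assumes f: "psdf d f" and ij: "i < d" "j < d"
  shows "norm (f (i, j)) \<le> (Re (f (i, i)) + Re (f (j, j))) / 2"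
proof (cases "f (i, j) = 0")
  case True
  then show ?thesis using psdf_diag(2)[OF f] ij by simp
next
  case False
  define z where "z = - (cnj (f (i, j)) / norm (f (i, j)))"
  have zz: "z * cnj z = 1"
    using False by (simp add: z_def complex_norm_square[symmetric] power2_eq_square field_simps)
  have zf: "z * f (i, j) = - complex_of_real (norm (f (i, j)))"
    using False by (simp add: z_def field_simps complex_norm_square[symmetric] power2_eq_square flip: of_real_mult)
  have "0 \<le> Re (bform d f (\<lambda>l. unit_fun i l + z * unit_fun j l) (\<lambda>l. unit_fun i l + z * unit_fun j l))"
    by (rule psdf_nonneg[OF f])
  also have "\<dots> = Re (f (i, i) + z * f (i, j) + cnj (z * f (i, j)) + z * cnj z * f (j, j))"
    unfolding bform_add_scaled_unit[OF f ij(2)] bform_unit_unit[OF ij(1) ij(1)] bform_unit_unit[OF ij] ..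
  finally show ?thesis unfolding zf zz by simp
qed

lemma psdf_entry_le_trace:
  assumes f: "psdf d f" and ij: "i < d" "j < d"
  shows "norm (f (i, j)) \<le> (\<Sum>k<d. Re (f (k, k)))"
proof -
  have "Re (f (k, k)) \<le> (\<Sum>k<d. Re (f (k, k)))" if "k < d" for k
    using that psdf_diag(2)[OF f] by (intro member_le_sum) auto
  from this[OF ij(1)] this[OF ij(2)]
  have "(Re (f (i, i)) + Re (f (j, j))) / 2 \<le> (\<Sum>k<d. Re (f (k, k)))"
    by simp
  with psdf_entry_bound[OF f ij] show ?thesis by (rule order_trans)
qed

text \<open>One step of Cholesky elimination; the new matrix has a zero diagonal entry at \<open>k\<close>, which makes
  the induction on the number of nonzero diagonal entries below work.\<close>

lemma psdf_schur_complement: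
  assumes f: "psdf d f" and k: "k < d" "f (k, k) \<noteq> 0"
  shows "psdf d (\<lambda>(i, j). f (i, j) - f (i, k) * cnj (f (j, k)) / f (k, k))"
    (is "psdf d ?g")
proof -
  have a: "f (k, k) = complex_of_real (Re (f (k, k)))" "0 < Re (f (k, k))"
    using psdf_diag[OF f k(1)] k(2) by (auto simp: less_le complex_eq_iff)
  have "0 \<le> Re (bform d ?g v v)" for v
  proof -
    define s where "s = bform d f v (unit_fun k)"
    \<comment> \<open>The minimiser of the form over the line through \<open>v\<close> in the
      \<open>k\<close>-th direction; completing the square shows that the minimum is the value of
      the reduced form at \<open>v\<close>.\<close>
    define z where "z = - (cnj s / f (k, k))"
    have "bform d ?g v v = bform d f v v - s * cnj s / f (k, k)"
    proof -
      have "bform d ?g v v = bform d f v v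
          - (\<Sum>i<d. \<Sum>j<d. (cnj (v i) * f (i, k)) * (v j * cnj (f (j, k)))) / f (k, k)"
        by (simp add: bform_def sum_subtractf sum_divide_distrib diff_divide_distrib algebra_simps)
      then show ?thesis
        by (simp add: s_def bform_unit_right[OF k(1)] sum_product cnj_sum)
    qed
    also have "\<dots> = bform d f (\<lambda>i. v i + z * unit_fun k i) (\<lambda>i. v i + z * unit_fun k i)"
    proof -
      have "cnj (f (k, k)) = f (k, k)" using a by (metis complex_cnj_complex_of_real)
      then show ?thesis
        unfolding bform_add_scaled_unit[OF f k(1)] s_def[symmetric] z_def
        using k(2) by (simp add: field_simps)
    qed
    finally show ?thesis using psdf_nonneg[OF f] by simp
  qed
  moreover have "cnj (?g (i, j)) = ?g (j, i)" if "i < d" "j < d" for i j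
    using psdf_cnj[OF f] that k by simp
  ultimately show ?thesis by (rule psdfI[rotated])
qed

text \<open>Repeated elimination ends at a matrix with zero diagonal, hence at 0, and each step
  splits off one rank-one term. The decomposition takes the place of the spectral theorem:
  positivity of pairings and of tensor products is reduced by it to values of a form.\<close>

lemma psdf_rank_one_decomposition:
  assumes "psdf d f"
  shows "\<exists>n u. \<forall>i<d. \<forall>j<d. f (i, j) = (\<Sum>m<n::nat. u m i * cnj (u m j))"
  using assms
proof (induction "card {k. k < d \<and> f (k, k) \<noteq> 0}" arbitrary: f rule: less_induct)
  case (less f)
  note f = less.prems
  show ?case
  proof (cases "\<exists>k<d. f (k, k) \<noteq> 0")
    case False
    have "f (i, j) = 0" if "i < d" "j < d" for i j
      using psdf_entry_bound[OF f that] False that by auto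
    then show ?thesis by (intro exI[of _ 0]) simp
  next
    case True
    then obtain k where k: "k < d" "f (k, k) \<noteq> 0" by blast
    define r where "r = Re (f (k, k))"
    have r: "f (k, k) = complex_of_real r" "0 < r"
      using psdf_diag[OF f k(1)] k(2) by (auto simp: r_def less_le complex_eq_iff)
    define g where "g = (\<lambda>(i, j). f (i, j) - f (i, k) * cnj (f (j, k)) / f (k, k))"
    have g: "psdf d g" unfolding g_def by (rule psdf_schur_complement[OF f k])
    \<comment> \<open>Elimination can only lower a diagonal entry and positivity keeps it
      nonnegative, so a zero entry stays zero.\<close>
    have "g (i, i) = 0" if "i < d" "f (i, i) = 0" for i
    proof -
      have "Re (g (i, i)) = - ((norm (f (i, k)))\<^sup>2 / r)"
        using that by (simp add: g_def r complex_norm_square[symmetric] flip: of_real_power)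
      then have "Re (g (i, i)) \<le> 0" using r by simp
      then show ?thesis using psdf_diag[OF g that(1)] by (auto simp: complex_eq_iff)
    qed
    moreover have "g (k, k) = 0"
      using r k by (simp add: g_def)
    ultimately have "{i. i < d \<and> g (i, i) \<noteq> 0} \<subset> {i. i < d \<and> f (i, i) \<noteq> 0}"
      using k by blast
    then have "card {i. i < d \<and> g (i, i) \<noteq> 0} < card {i. i < d \<and> f (i, i) \<noteq> 0}"
      by (intro psubset_card_mono) auto
    from less.hyps[OF this g] obtain n u where
      u: "\<And>i j. i < d \<Longrightarrow> j < d \<Longrightarrow> g (i, j) = (\<Sum>m<n::nat. u m i * cnj (u m j))"
      by blast
    \<comment> \<open>The new vector is the \<open>k\<close>-th column divided by the root of the
      pivot; its rank-one matrix is exactly what elimination subtracted.\<close>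
    define w where "w = (\<lambda>m. if m = n then (\<lambda>i. f (i, k) / complex_of_real (sqrt r)) else u m)"
    have "f (i, j) = (\<Sum>m<Suc n. w m i * cnj (w m j))" if "i < d" "j < d" for i j
    proof -
      have "w n i * cnj (w n j) = f (i, k) * cnj (f (j, k)) / f (k, k)"
        using r by (simp add: w_def flip: of_real_mult)
      moreover have "(\<Sum>m<n. w m i * cnj (w m j)) = g (i, j)"
        using u[OF that] by (simp add: w_def)
      ultimately show ?thesis by (simp add: g_def)
    qed
    then show ?thesis by blast
  qed
qed

section \<open>Measure-and-prepare maps\<close>

lemma sum_lessThan_mult:
  "(\<Sum>i<k * (d::nat). g i) = (\<Sum>a<k. \<Sum>p<d. g (a * d + p))"
proof -
  have "(\<Sum>i<k * d. g i) = (\<Sum>a<k. sum g {a * d..<a * d + d})"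
    by (rule sum.nat_group[symmetric])
  also have "\<dots> = (\<Sum>a<k. \<Sum>p<d. g (a * d + p))"
  proof (rule sum.cong[OF refl])
    fix a
    show "sum g {a * d..<a * d + d} = (\<Sum>p<d. g (a * d + p))"
      using sum.atLeastLessThan_shift_0[of g "a * d" "a * d + d"] by (simp add: lessThan_atLeast0)
  qed
  finally show ?thesis .
qed

text \<open>This is \<open>X\<close> with the pairing against \<open>A\<close> applied to every
  block. For \<open>A\<close> a sum of rank-one terms, its form at \<open>v\<close> is the sum over
  \<open>m\<close> of the forms of \<open>X\<close> at the tensor products of \<open>v\<close> with
  \<open>u m\<close>.\<close>

lemma psdf_block_trace:
  assumes A: "psdf d A" and X: "psdf (k * d) X"
  shows "psdf k (\<lambda>(a, b). \<Sum>p<d. \<Sum>q<d. A (q, p) * X (a * d + p, b * d + q))"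
    (is "psdf k ?M")
proof (rule psdfI)
  have lt: "a * d + p < k * d" if "a < k" "p < d" for a p
  proof -
    have "a * d + p < Suc a * d" using that by simp
    also have "\<dots> \<le> k * d" using that by (intro mult_right_mono) auto
    finally show ?thesis .
  qed
  fix a b assume "a < k" "b < k"
  then show "cnj (?M (a, b)) = ?M (b, a)"
    unfolding prod.case cnj_sum
    by (subst sum.swap, intro sum.cong refl) (auto simp: psdf_cnj[OF A] psdf_cnj[OF X] lt)
next
  fix v
  obtain n u where u: "\<And>i j. i < d \<Longrightarrow> j < d \<Longrightarrow> A (i, j) = (\<Sum>m<n::nat. u m i * cnj (u m j))"
    using psdf_rank_one_decomposition[OF A] by blast
  define T where "T m a p b q = cnj (v a * u m p) * X (a * d + p, b * d + q) * (v b * u m q)" for m a p b q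
  have "bform k ?M v v = (\<Sum>a<k. \<Sum>b<k. \<Sum>p<d. \<Sum>q<d. \<Sum>m<n. T m a p b q)"
    unfolding bform_def prod.case sum_distrib_left sum_distrib_right
    by (intro sum.cong refl) (auto simp: u T_def sum_distrib_left sum_distrib_right intro!: sum.cong)
  also have "\<dots> = (\<Sum>a<k. \<Sum>p<d. \<Sum>b<k. \<Sum>q<d. \<Sum>m<n. T m a p b q)"
    by (intro sum.cong refl sum.swap)
  \<comment> \<open>Read from right to left, the sum over \<open>m\<close> moves inwards past one
    index at a time.\<close>
  also have "\<dots> = (\<Sum>m<n. \<Sum>a<k. \<Sum>p<d. \<Sum>b<k. \<Sum>q<d. T m a p b q)"
    by (rule sym, subst sum.swap, rule sum.cong[OF refl], subst sum.swap, rule sum.cong[OF refl],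
        subst sum.swap, rule sum.cong[OF refl], rule sum.swap)
  also have "\<dots> = (\<Sum>m<n. bform (k * d) X (\<lambda>i. v (i div d) * u m (i mod d)) (\<lambda>i. v (i div d) * u m (i mod d)))"
    unfolding bform_def sum_lessThan_mult by (intro sum.cong refl) (auto simp: T_def)
  finally show "0 \<le> Re (bform k ?M v v)"
    using psdf_nonneg[OF X] by (simp add: sum_nonneg)
qed

text \<open>For \<open>P\<close> a sum of rank-one terms, the form at \<open>v\<close> is the sum
  over \<open>m\<close> of the forms of \<open>M\<close> at the vectors obtained by contracting the
  second index of \<open>v\<close> with \<open>u m\<close>.\<close>

lemma psdf_tensor:
  assumes M: "psdf k M" and P: "psdf d P"
  shows "psdf (k * d) (\<lambda>(i, j). M (i div d, j div d) * P (i mod d, j mod d))"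
    (is "psdf _ ?f")
proof (cases "d = 0")
  case True
  then show ?thesis by (simp add: psdf_def bform_def)
next
  case False
  show ?thesis
  proof (rule psdfI)
    fix i j assume "i < k * d" "j < k * d"
    then show "cnj (?f (i, j)) = ?f (j, i)"
      using False by (simp add: psdf_cnj[OF M] psdf_cnj[OF P] less_mult_imp_div_less)
  next
    fix v
    obtain n u where u: "\<And>i j. i < d \<Longrightarrow> j < d \<Longrightarrow> P (i, j) = (\<Sum>m<n::nat. u m i * cnj (u m j))"
      using psdf_rank_one_decomposition[OF P] by blast
    define T where "T m a p b q = cnj (v (a * d + p) * cnj (u m p)) * M (a, b) * (v (b * d + q) * cnj (u m q))" for m a p b q
    have "bform (k * d) ?f v v = (\<Sum>a<k. \<Sum>p<d. \<Sum>b<k. \<Sum>q<d. \<Sum>m<n. T m a p b q)"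
      unfolding bform_def sum_lessThan_mult
      by (intro sum.cong refl) (auto simp: u T_def sum_distrib_left sum_distrib_right intro!: sum.cong)
    also have "\<dots> = (\<Sum>m<n. \<Sum>a<k. \<Sum>p<d. \<Sum>b<k. \<Sum>q<d. T m a p b q)"
      by (rule sym, subst sum.swap, rule sum.cong[OF refl], subst sum.swap, rule sum.cong[OF refl],
          subst sum.swap, rule sum.cong[OF refl], rule sum.swap)
    also have "\<dots> = (\<Sum>m<n. \<Sum>a<k. \<Sum>b<k. \<Sum>p<d. \<Sum>q<d. T m a p b q)"
      by (intro sum.cong refl sum.swap)
    also have "\<dots> = (\<Sum>m<n. bform k M (\<lambda>a. \<Sum>p<d. v (a * d + p) * cnj (u m p)) (\<lambda>a. \<Sum>p<d. v (a * d + p) * cnj (u m p)))"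
      unfolding bform_def T_def cnj_sum sum_distrib_left sum_distrib_right
      by (intro sum.cong refl sum.swap)
    finally show "0 \<le> Re (bform (k * d) ?f v v)"
      using psdf_nonneg[OF M] by (simp add: sum_nonneg)
  qed
qed

section \<open>The trace pairing and the maps built from it\<close>

definition trace_prod :: "nat \<Rightarrow> complex mat \<Rightarrow> complex mat \<Rightarrow> complex" where
  "trace_prod d A X = (\<Sum>i<d. \<Sum>j<d. A $$ (j, i) * X $$ (i, j))"

lemma trace_prod_add: "X \<in> carrier_mat d d \<Longrightarrow> Y \<in> carrier_mat d d \<Longrightarrow> trace_prod d A (X + Y) = trace_prod d A X + trace_prod d A Y"
  by (simp add: trace_prod_def sum.distrib[symmetric] algebra_simps)

lemma trace_prod_smult: "X \<in> carrier_mat d d \<Longrightarrow> trace_prod d A (c \<cdot>\<^sub>m X) = c * trace_prod d A X"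
  by (simp add: trace_prod_def sum_distrib_left algebra_simps)

text \<open>Expanding \<open>A\<close> into rank-one terms turns the pairing into a sum of values of
  the form of \<open>X\<close>.\<close>

lemma trace_prod_psd_real_nonneg:
  assumes A: "psd d A" and X: "psd d X"
  shows "trace_prod d A X = complex_of_real (Re (trace_prod d A X))" "0 \<le> Re (trace_prod d A X)"
proof -
  have A': "psdf d (($$) A)" and X': "psdf d (($$) X)"
    using A X by (auto simp: psd_iff_psdf)
  obtain n u where u: "\<And>i j. i < d \<Longrightarrow> j < d \<Longrightarrow> A $$ (i, j) = (\<Sum>m<n::nat. u m i * cnj (u m j))"
    using psdf_rank_one_decomposition[OF A'] by blast
  have "trace_prod d A X = (\<Sum>i<d. \<Sum>j<d. \<Sum>m<n. cnj (u m i) * X $$ (i, j) * u m j)"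
    unfolding trace_prod_def
    by (intro sum.cong refl) (auto simp: u sum_distrib_left sum_distrib_right intro!: sum.cong)
  also have "\<dots> = (\<Sum>m<n. bform d (($$) X) (u m) (u m))"
    unfolding bform_def
    by (rule sym, subst sum.swap, rule sum.cong[OF refl], rule sum.swap)
  also have "\<dots> = (\<Sum>m<n. complex_of_real (Re (bform d (($$) X) (u m) (u m))))"
    by (intro sum.cong refl bform_self_real[OF X'])
  finally have eq: "trace_prod d A X = complex_of_real (\<Sum>m<n. Re (bform d (($$) X) (u m) (u m)))"
    by simp
  show "trace_prod d A X = complex_of_real (Re (trace_prod d A X))"
    unfolding eq by simp
  show "0 \<le> Re (trace_prod d A X)"
    unfolding eq using psdf_nonneg[OF X'] by (simp add: sum_nonneg)
qed

lemma psd_trace_real_nonneg: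
  assumes "psd d X"
  shows "mtrace X = complex_of_real (Re (mtrace X))" "0 \<le> Re (mtrace X)"
    "Re (mtrace X) = (\<Sum>k<d. Re (X $$ (k, k)))"
proof -
  have X: "psdf d (($$) X)" "dim_row X = d" using assms by (auto simp: psd_iff_psdf)
  show eq: "Re (mtrace X) = (\<Sum>k<d. Re (X $$ (k, k)))"
    using X by (simp add: mtrace_def)
  show "0 \<le> Re (mtrace X)"
    unfolding eq using psdf_diag(2)[OF X(1)] by (intro sum_nonneg) auto
  show "mtrace X = complex_of_real (Re (mtrace X))"
    unfolding eq of_real_sum unfolding mtrace_def X(2)
    by (intro sum.cong refl) (use psdf_diag(1)[OF X(1)] in auto)
qed

lemma psd_entry_le_trace:
  "psd d X \<Longrightarrow> i < d \<Longrightarrow> j < d \<Longrightarrow> norm (X $$ (i, j)) \<le> Re (mtrace X)"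
  using psdf_entry_le_trace[of d "($$) X"] psd_trace_real_nonneg(3) by (auto simp: psd_iff_psdf)

text \<open>A crude bound, from the fact that no entry of a positive matrix exceeds its trace in
  modulus; it only has to provide some finite constant by which a map can be scaled down.\<close>

lemma trace_prod_le_trace:
  assumes X: "psd d X"
  shows "Re (trace_prod d A X) \<le> (\<Sum>i<d. \<Sum>j<d. norm (A $$ (j, i))) * Re (mtrace X)"
proof -
  have "Re (trace_prod d A X) \<le> norm (trace_prod d A X)" by (rule complex_Re_le_cmod)
  also have "\<dots> \<le> (\<Sum>i<d. \<Sum>j<d. norm (A $$ (j, i) * X $$ (i, j)))"
    unfolding trace_prod_def by (intro order_trans[OF norm_sum] sum_mono) auto
  also have "\<dots> \<le> (\<Sum>i<d. \<Sum>j<d. norm (A $$ (j, i)) * Re (mtrace X))"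
    unfolding norm_mult using psd_entry_le_trace[OF X] by (intro sum_mono mult_left_mono) auto
  finally show ?thesis by (simp add: sum_distrib_right)
qed

lemma psd_smult: "psd d A \<Longrightarrow> 0 \<le> c \<Longrightarrow> psd d (complex_of_real c \<cdot>\<^sub>m A)"
  unfolding psd_iff_psdf
  using psdf_scale[of d "($$) A" c] psdf_cong[of d "($$) (complex_of_real c \<cdot>\<^sub>m A)" "\<lambda>x. complex_of_real c * A $$ x"]
  by auto

lemma mtrace_add: "X \<in> carrier_mat d d \<Longrightarrow> Y \<in> carrier_mat d d \<Longrightarrow> mtrace (X + Y) = mtrace X + mtrace Y"
  by (simp add: mtrace_def sum.distrib)

lemma mtrace_smult: "mtrace (c \<cdot>\<^sub>m X) = c * mtrace X" if "X \<in> carrier_mat d d"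
  using that by (simp add: mtrace_def sum_distrib_left)

definition measure_prepare :: "nat \<Rightarrow> complex mat \<Rightarrow> complex mat \<Rightarrow> complex mat \<Rightarrow> complex mat \<Rightarrow> complex mat \<Rightarrow> complex mat" where
  "measure_prepare d A B P Q X = trace_prod d A X \<cdot>\<^sub>m P + trace_prod d B X \<cdot>\<^sub>m Q"

text \<open>Amplifying \<open>X \<mapsto> tr (A X) P\<close> gives the tensor product of the
  blockwise pairing with \<open>A\<close> and the matrix \<open>P\<close>, so
  \<open>psdf_block_trace\<close> and \<open>psdf_tensor\<close> combine.\<close>

lemma measure_prepare_completely_positive:
  assumes A: "psd d A" and B: "psd d B" and P: "psd d' P" and Q: "psd d' Q"
  shows "completely_positive d d' (measure_prepare d A B P Q)"
  unfolding completely_positive_def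
proof (intro conjI allI impI)
  have PQ: "P \<in> carrier_mat d' d'" "Q \<in> carrier_mat d' d'"
    using P Q by (auto simp: psd_def)
  show "lin_map d d' (measure_prepare d A B P Q)"
    unfolding lin_map_def measure_prepare_def
    using PQ by (auto simp: trace_prod_add trace_prod_smult intro!: eq_matI) (auto simp: algebra_simps)
  fix k X assume X: "psd (k * d) X"
  define M where "M C = (\<lambda>(a, b). \<Sum>p<d. \<Sum>q<d. C $$ (q, p) * X $$ (a * d + p, b * d + q))" for C :: "complex mat"
  define f where "f C R = (\<lambda>(i, j). M C (i div d', j div d') * R $$ (i mod d', j mod d'))" for C R :: "complex mat"
  have f: "psdf (k * d') (f C R)" if "psd d C" "psd d' R" for C R
    unfolding f_def M_def using that X
    by (intro psdf_tensor psdf_block_trace) (auto simp: psd_iff_psdf)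
  have "psdf (k * d') (\<lambda>x. f A P x + f B Q x)"
    using A B P Q by (intro psdf_add f)
  moreover have "ampl k d d' (measure_prepare d A B P Q) X $$ (i, j) = f A P (i, j) + f B Q (i, j)"
    if ij: "i < k * d'" "j < k * d'" for i j
  proof -
    have "d' > 0" using ij by (cases "d' = 0") auto
    then show ?thesis
      using ij PQ by (simp add: ampl_def measure_prepare_def f_def M_def trace_prod_def block_def)
  qed
  ultimately have "psdf (k * d') (($$) (ampl k d d' (measure_prepare d A B P Q) X))"
    using psdf_cong[of "k * d'" "($$) (ampl k d d' (measure_prepare d A B P Q) X)" "\<lambda>x. f A P x + f B Q x"] by simp
  then show "psd (k * d') (ampl k d d' (measure_prepare d A B P Q) X)"
    by (simp add: psd_iff_psdf ampl_def)
qed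

text \<open>Complete positivity and the preservation of cones survive positive scaling, so a small
  factor \<open>c\<close> achieves the trace condition. That condition in turn bounds the weight of
  each free output by 1.\<close>

lemma measure_prepare_free_op:
  assumes F: "free_set d F" and F': "free_set d' F'"
    and psd: "psd d A" "psd d B" "psd d' P" "psd d' Q"
    and inv: "\<And>\<sigma>. \<sigma> \<in> F \<Longrightarrow> measure_prepare d A B P Q \<sigma> \<in> Defs.cone F'"
  shows "\<exists>c>0. \<exists>E\<in>free_ops d F d' F'. \<forall>X. E X = complex_of_real c \<cdot>\<^sub>m measure_prepare d A B P Q X"
proof -
  define nA where "nA = (\<Sum>i<d. \<Sum>j<d. norm (A $$ (j, i)))"
  define nB where "nB = (\<Sum>i<d. \<Sum>j<d. norm (B $$ (j, i)))"
  define tP where "tP = Re (mtrace P)"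
  define tQ where "tQ = Re (mtrace Q)"
  have nn: "0 \<le> nA" "0 \<le> nB" "0 \<le> tP" "0 \<le> tQ"
    using psd_trace_real_nonneg(2) psd by (auto simp: nA_def nB_def tP_def tQ_def intro!: sum_nonneg)
  have PQ: "P \<in> carrier_mat d' d'" "Q \<in> carrier_mat d' d'"
    using psd by (auto simp: psd_def)
  have tr: "mtrace P = complex_of_real tP" "mtrace Q = complex_of_real tQ"
    using psd_trace_real_nonneg(1)[OF psd(3)] psd_trace_real_nonneg(1)[OF psd(4)]
    by (auto simp: tP_def tQ_def)
  \<comment> \<open>The unscaled map multiplies traces by at most \<open>nA * tP + nB * tQ\<close>;
    the added 1 keeps the denominator positive.\<close>
  define c where "c = 1 / (1 + nA * tP + nB * tQ)"
  have pos: "1 + nA * tP + nB * tQ > 0" using nn by (simp add: add_pos_nonneg)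
  then have c: "c > 0" by (simp add: c_def)
  define E where "E = measure_prepare d A B (complex_of_real c \<cdot>\<^sub>m P) (complex_of_real c \<cdot>\<^sub>m Q)"
  have E: "E X = complex_of_real c \<cdot>\<^sub>m measure_prepare d A B P Q X" for X
    unfolding E_def measure_prepare_def using PQ by (intro eq_matI) (auto simp: algebra_simps)
  have trE: "Re (mtrace (E X)) = c * (Re (trace_prod d A X) * tP + Re (trace_prod d B X) * tQ)" for X
    unfolding E measure_prepare_def using PQ
    by (simp add: mtrace_smult[of _ d'] mtrace_add[of _ d'] tr)
  have tni: "Re (mtrace (E X)) \<le> Re (mtrace X)" if X: "psd d X" for X
  proof -
    have "Re (trace_prod d A X) * tP + Re (trace_prod d B X) * tQ
      \<le> nA * Re (mtrace X) * tP + nB * Re (mtrace X) * tQ"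
      using trace_prod_le_trace[OF X, of A] trace_prod_le_trace[OF X, of B] nn
      by (intro add_mono mult_right_mono) (auto simp: nA_def nB_def)
    also have "\<dots> \<le> (1 + nA * tP + nB * tQ) * Re (mtrace X)"
      using psd_trace_real_nonneg(2)[OF X] by (simp add: algebra_simps)
    finally have "c * (Re (trace_prod d A X) * tP + Re (trace_prod d B X) * tQ)
      \<le> c * ((1 + nA * tP + nB * tQ) * Re (mtrace X))"
      using c by (intro mult_left_mono) auto
    also have "\<dots> = Re (mtrace X)" using pos by (simp add: c_def)
    finally show ?thesis by (simp add: trE)
  qed
  have "E \<in> free_ops d F d' F'"
    unfolding free_ops_def
  proof (intro CollectI conjI ballI)
    show "completely_positive d d' E"
      unfolding E_def using psd c by (intro measure_prepare_completely_positive psd_smult) auto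
    show "trace_nonincreasing d E"
      using tni by (simp add: trace_nonincreasing_def)
    fix \<sigma> assume \<sigma>: "\<sigma> \<in> F"
    then have ds: "density d \<sigma>" using F by (simp add: free_set_def)
    obtain l \<tau> where l: "0 \<le> l" "\<tau> \<in> F'" "measure_prepare d A B P Q \<sigma> = complex_of_real l \<cdot>\<^sub>m \<tau>"
      using inv[OF \<sigma>] by (auto simp: Defs.cone_def)
    have dt: "density d' \<tau>" using l F' by (simp add: free_set_def)
    then have "\<tau> \<in> carrier_mat d' d'" by (simp add: density_def psd_def)
    have E\<sigma>: "E \<sigma> = complex_of_real (c * l) \<cdot>\<^sub>m \<tau>"
      unfolding E l(3) by (intro eq_matI) auto
    \<comment> \<open>The weight of the free state \<open>\<tau>\<close> is the trace of the output,
      which is at most the trace 1 of \<open>\<sigma>\<close>.\<close>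
    have "c * l = Re (mtrace (E \<sigma>))"
      unfolding E\<sigma> mtrace_smult[OF \<open>\<tau> \<in> carrier_mat d' d'\<close>] using dt by (simp add: density_def)
    also have "\<dots> \<le> 1" using tni[of \<sigma>] ds by (simp add: density_def)
    finally show "\<exists>\<sigma>'\<in>F'. \<exists>p. 0 \<le> p \<and> p \<le> 1 \<and> E \<sigma> = complex_of_real p \<cdot>\<^sub>m \<sigma>'"
      using E\<sigma> l c by (intro bexI[of _ \<tau>] exI[of _ "c * l"]) auto
  qed
  then show ?thesis using c E by blast
qed

section \<open>Duality for the projective robustness\<close>

lemma density_carrier: "density d X \<Longrightarrow> X \<in> carrier_mat d d"
  by (simp add: density_def psd_def)

lemma free_set_density: "free_set d F \<Longrightarrow> \<sigma> \<in> F \<Longrightarrow> density d \<sigma>"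
  by (simp add: free_set_def)

lemma psd_diff_smult_iff:
  assumes "X \<in> carrier_mat d d" "Y \<in> carrier_mat d d"
  shows "psd d (a \<cdot>\<^sub>m X - b \<cdot>\<^sub>m Y) \<longleftrightarrow> psdf d (\<lambda>x. a * X $$ x - b * Y $$ x)"
  using assms psdf_cong[of d "($$) (a \<cdot>\<^sub>m X - b \<cdot>\<^sub>m Y)" "\<lambda>x. a * X $$ x - b * Y $$ x"]
  by (auto simp: psd_iff_psdf)

lemma loewner_le_smult_iff:
  assumes "X \<in> carrier_mat d d" "Y \<in> carrier_mat d d"
  shows "loewner_le d X (a \<cdot>\<^sub>m Y) \<longleftrightarrow> psdf d (\<lambda>x. a * Y $$ x - X $$ x)"
proof -
  have "a \<cdot>\<^sub>m Y - X = a \<cdot>\<^sub>m Y - 1 \<cdot>\<^sub>m X" using assms by (intro eq_matI) auto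
  then show ?thesis
    using psd_diff_smult_iff[OF assms(2,1), of a 1] assms by (simp add: loewner_le_def)
qed

lemma density_trace_sum: "density d X \<Longrightarrow> (\<Sum>k<d. Re (X $$ (k, k))) = 1"
  using psd_trace_real_nonneg(3)[of d X] by (simp add: density_def)

lemma psdf_trace_nonneg: "psdf d f \<Longrightarrow> 0 \<le> (\<Sum>k<d. Re (f (k, k)))"
  using psdf_diag(2)[of d f] by (intro sum_nonneg) auto

text \<open>The positive matrix \<open>l Y - X\<close> has trace \<open>l - 1\<close>.\<close>

lemma loewner_le_density_ge_1:
  assumes "density d X" "density d Y" "loewner_le d X (complex_of_real l \<cdot>\<^sub>m Y)"
  shows "1 \<le> l"
proof -
  have "psdf d (\<lambda>x. complex_of_real l * Y $$ x - X $$ x)"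
    using assms loewner_le_smult_iff density_carrier by metis
  from psdf_trace_nonneg[OF this] show ?thesis
    using density_trace_sum[OF assms(1)] density_trace_sum[OF assms(2)]
    by (simp add: sum_subtractf flip: sum_distrib_left)
qed

lemma Rmax_ge_1:
  assumes "density d X" "density d Y"
  shows "1 \<le> Rmax d X Y"
  unfolding Rmax_def
  using loewner_le_density_ge_1[OF assms] by (intro Inf_greatest) auto

lemma Rmax_le: "loewner_le d X (complex_of_real l \<cdot>\<^sub>m Y) \<Longrightarrow> Rmax d X Y \<le> ereal l"
  unfolding Rmax_def by (intro Inf_lower) auto

text \<open>The chain \<open>\<rho> \<le> l \<sigma> \<le> t \<rho>\<close> bounds the two
  max-relative quantities by \<open>l\<close> and \<open>t / l\<close>, and \<open>l\<close> cancels
  in the product. Both quantities are at least 1, which makes multiplication in the extended reals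
  monotone here.\<close>

lemma OmegaF_le:
  assumes F: "free_set d F" and \<rho>: "density d \<rho>" and \<sigma>: "\<sigma> \<in> F"
    and le: "psdf d (\<lambda>x. complex_of_real l * \<sigma> $$ x - \<rho> $$ x)"
    and ge: "psdf d (\<lambda>x. complex_of_real t * \<rho> $$ x - complex_of_real l * \<sigma> $$ x)"
  shows "OmegaF d F \<rho> \<le> ereal t"
proof -
  have d\<sigma>: "density d \<sigma>" using free_set_density[OF F \<sigma>] .
  note carr = density_carrier[OF \<rho>] density_carrier[OF d\<sigma>]
  have L1: "loewner_le d \<rho> (complex_of_real l \<cdot>\<^sub>m \<sigma>)"
    using le loewner_le_smult_iff[OF carr] by simp
  then have l: "1 \<le> l" by (rule loewner_le_density_ge_1[OF \<rho> d\<sigma>])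
  have "psdf d (\<lambda>x. complex_of_real (1 / l) * (complex_of_real t * \<rho> $$ x - complex_of_real l * \<sigma> $$ x))"
    using ge l by (intro psdf_scale) auto
  also have "(\<lambda>x. complex_of_real (1 / l) * (complex_of_real t * \<rho> $$ x - complex_of_real l * \<sigma> $$ x))
    = (\<lambda>x. complex_of_real (t / l) * \<rho> $$ x - \<sigma> $$ x)"
    using l by (simp add: fun_eq_iff field_simps)
  finally have L2: "loewner_le d \<sigma> (complex_of_real (t / l) \<cdot>\<^sub>m \<rho>)"
    using loewner_le_smult_iff[OF carr(2,1)] by simp
  have "OmegaF d F \<rho> \<le> Rmax d \<rho> \<sigma> * Rmax d \<sigma> \<rho>"
    unfolding OmegaF_def using \<sigma> by (rule INF_lower)
  also have "\<dots> \<le> ereal l * ereal (t / l)"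
    using Rmax_le[OF L1] Rmax_le[OF L2] order_trans[OF _ Rmax_ge_1[OF d\<sigma> \<rho>], of 0]
      order_trans[OF _ Rmax_ge_1[OF \<rho> d\<sigma>], of 0]
    by (intro ereal_mult_mono') auto
  also have "\<dots> = ereal t" using l by simp
  finally show ?thesis .
qed

section \<open>Limits, compactness and the closed cone of sandwiched pairs\<close>

lemma tendsto_coordinate:
  fixes X :: "'a \<Rightarrow> 'i \<Rightarrow> 'b::topological_space"
  assumes "(X \<longlongrightarrow> l) G"
  shows "((\<lambda>n. X n i) \<longlongrightarrow> l i) G"
  by (rule continuous_on_tendsto_compose[OF continuous_on_coordinate[of UNIV] assms]) auto

lemma psdf_limit:
  assumes psd: "\<And>n::nat. psdf d (f n)"
    and lim: "\<And>i j. i < d \<Longrightarrow> j < d \<Longrightarrow> (\<lambda>n. f n (i, j)) \<longlonglongrightarrow> g (i, j)"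
  shows "psdf d g"
proof (rule psdfI)
  fix i j assume ij: "i < d" "j < d"
  have "(\<lambda>n. cnj (f n (i, j))) \<longlonglongrightarrow> cnj (g (i, j))"
    using lim[OF ij] by (rule tendsto_cnj)
  moreover have "(\<lambda>n. cnj (f n (i, j))) \<longlonglongrightarrow> g (j, i)"
    using lim[OF ij(2,1)] by (simp add: psdf_cnj[OF psd] ij)
  ultimately show "cnj (g (i, j)) = g (j, i)" by (rule LIMSEQ_unique)
next
  fix v
  have "(\<lambda>n. Re (bform d (f n) v v)) \<longlonglongrightarrow> Re (bform d g v v)"
    unfolding bform_def by (intro tendsto_intros lim) auto
  then show "0 \<le> Re (bform d g v v)"
    by (rule LIMSEQ_le_const) (use psdf_nonneg[OF psd] in auto)
qed

text \<open>Padding by 0 places matrices in a function space whose product topology expresses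
  entrywise convergence.\<close>

definition fun_of_mat :: "nat \<Rightarrow> complex mat \<Rightarrow> nat \<times> nat \<Rightarrow> complex" where
  "fun_of_mat d A = (\<lambda>(i, j). if i < d \<and> j < d then A $$ (i, j) else 0)"

text \<open>Closedness is assumed of a free set, and boundedness holds because entries of a density
  operator have modulus at most its trace 1.\<close>

lemma compact_fun_of_free_set:
  assumes F: "free_set d F"
  shows "compact (fun_of_mat d ` F)"
proof -
  let ?J = "{..<d} \<times> {..<d}"
  have im: "fun_of_mat d ` F = {f. mat d d f \<in> F \<and> (\<forall>x. x \<notin> ?J \<longrightarrow> f x = 0)}"
  proof (intro equalityI subsetI)
    fix f assume "f \<in> fun_of_mat d ` F"
    then obtain \<sigma> where \<sigma>: "\<sigma> \<in> F" "f = fun_of_mat d \<sigma>" by auto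
    have "\<sigma> \<in> carrier_mat d d" using \<sigma> free_set_density[OF F] density_carrier by blast
    then have "mat d d f = \<sigma>" by (auto simp: \<sigma> fun_of_mat_def)
    then show "f \<in> {f. mat d d f \<in> F \<and> (\<forall>x. x \<notin> ?J \<longrightarrow> f x = 0)}"
      using \<sigma> by (auto simp: fun_of_mat_def)
  next
    fix f assume "f \<in> {f. mat d d f \<in> F \<and> (\<forall>x. x \<notin> ?J \<longrightarrow> f x = 0)}"
    then have "mat d d f \<in> F" "f = fun_of_mat d (mat d d f)"
      by (auto simp: fun_of_mat_def)
    then show "f \<in> fun_of_mat d ` F" by blast
  qed
  have "closed (fun_of_mat d ` F)"
    unfolding closed_sequential_limits
  proof (intro allI impI, elim conjE)
    fix X l assume X: "\<forall>n. X n \<in> fun_of_mat d ` F" and l: "X \<longlonglongrightarrow> l"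
    have "mat d d l \<in> F"
    proof -
      have "mat_closed d F" using F by (simp add: free_set_def)
      moreover have "mat d d (X n) \<in> F" for n using X im by auto
      moreover have "(\<lambda>n. mat d d (X n) $$ (i, j)) \<longlonglongrightarrow> mat d d l $$ (i, j)" if "i < d" "j < d" for i j
        using tendsto_coordinate[OF l] that by simp
      ultimately show ?thesis
        unfolding mat_closed_def by (metis mat_carrier)
    qed
    moreover have "l x = 0" if "x \<notin> ?J" for x
    proof -
      have "X n x = 0" for n using X that unfolding im by blast
      then show ?thesis using tendsto_coordinate[OF l, of x] by (simp add: LIMSEQ_const_iff)
    qed
    ultimately show "l \<in> fun_of_mat d ` F" unfolding im by blast
  qed
  moreover have "fun_of_mat d ` F \<subseteq> {f. (\<forall>x\<in>?J. norm (f x) \<le> 1) \<and> (\<forall>x. x \<notin> ?J \<longrightarrow> f x = 0)}"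
  proof safe
    fix \<sigma> i j assume "\<sigma> \<in> F" "i < d" "j < d"
    then show "norm (fun_of_mat d \<sigma> (i, j)) \<le> 1"
      using free_set_density[OF F] psd_entry_le_trace[of d \<sigma> i j]
      by (simp add: fun_of_mat_def density_def)
  qed (auto simp: fun_of_mat_def split: if_splits)
  ultimately show ?thesis
    using compact_Int_closed[OF compact_supported_box[of ?J 1], of "fun_of_mat d ` F"]
    by (simp only: Int_absorb1)
qed

text \<open>The tag \<open>False\<close> marks the lower matrix and \<open>True\<close> the upper
  one, with the free element \<open>l \<sigma>\<close> in between. Storing the pair as a single
  function lets the separation theorem apply directly.\<close>

definition sandwich_cone :: "nat \<Rightarrow> complex mat set \<Rightarrow> (bool \<times> nat \<times> nat \<Rightarrow> complex) set" where
  "sandwich_cone d F = {g. (\<forall>b i j. \<not> (i < d \<and> j < d) \<longrightarrow> g (b, i, j) = 0) \<and>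
     (\<exists>l \<sigma>. 0 \<le> l \<and> \<sigma> \<in> F \<and> psdf d (\<lambda>x. complex_of_real l * \<sigma> $$ x - g (False, x))
        \<and> psdf d (\<lambda>x. g (True, x) - complex_of_real l * \<sigma> $$ x))}"

lemma sandwich_coneI:
  assumes "\<And>b i j. \<not> (i < d \<and> j < d) \<Longrightarrow> g (b, i, j) = 0" "0 \<le> l" "\<sigma> \<in> F"
    "psdf d (\<lambda>x. complex_of_real l * \<sigma> $$ x - g (False, x))"
    "psdf d (\<lambda>x. g (True, x) - complex_of_real l * \<sigma> $$ x)"
  shows "g \<in> sandwich_cone d F"
  using assms unfolding sandwich_cone_def by blast

lemma sandwich_cone_support:
  "g \<in> sandwich_cone d F \<Longrightarrow> \<not> (i < d \<and> j < d) \<Longrightarrow> g (b, i, j) = 0"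
  unfolding sandwich_cone_def by blast

text \<open>The multiplier \<open>l\<close> is controlled by the trace of the upper component, so limits of witnesses
  \<open>(l, \<sigma>)\<close> exist by compactness of the free set.\<close>

lemma closed_sandwich_cone:
  assumes F: "free_set d F"
  shows "closed (sandwich_cone d F)"
  unfolding closed_sequential_limits
proof (intro allI impI, elim conjE)
  fix X g assume X: "\<forall>n. X n \<in> sandwich_cone d F" and g: "X \<longlonglongrightarrow> g"
  define W where "W n p \<longleftrightarrow> 0 \<le> fst p \<and> snd p \<in> F
        \<and> psdf d (\<lambda>x. complex_of_real (fst p) * snd p $$ x - X n (False, x))
        \<and> psdf d (\<lambda>x. X n (True, x) - complex_of_real (fst p) * snd p $$ x)" for n p
  have "\<forall>n. \<exists>p. W n p"
    using X by (simp add: sandwich_cone_def W_def)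
  then obtain p where p: "\<And>n. W n (p n)"
    using choice[of W] by blast
  define l where "l n = fst (p n)" for n
  define \<sigma> where "\<sigma> n = snd (p n)" for n
  have l: "\<And>n. 0 \<le> l n" "\<And>n. \<sigma> n \<in> F"
    "\<And>n. psdf d (\<lambda>x. complex_of_real (l n) * \<sigma> n $$ x - X n (False, x))"
    "\<And>n. psdf d (\<lambda>x. X n (True, x) - complex_of_real (l n) * \<sigma> n $$ x)"
    using p unfolding W_def l_def \<sigma>_def by blast+
  have bound: "l n \<le> (\<Sum>k<d. Re (X n (True, k, k)))" for n
    using psdf_trace_nonneg[OF l(4)[of n]] density_trace_sum[OF free_set_density[OF F l(2)[of n]]]
    by (simp add: sum_subtractf flip: sum_distrib_left)
  have "(\<lambda>n. \<Sum>k<d. Re (X n (True, k, k))) \<longlonglongrightarrow> (\<Sum>k<d. Re (g (True, k, k)))"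
    by (intro tendsto_intros tendsto_coordinate[OF g])
  then have "Bseq (\<lambda>n. \<Sum>k<d. Re (X n (True, k, k)))"
    by (rule convergent_imp_Bseq[OF convergentI])
  then obtain L where L: "\<And>n. norm (\<Sum>k<d. Re (X n (True, k, k))) \<le> L"
    unfolding Bseq_def by blast
  have "l n \<le> L" for n
    using order_trans[OF bound abs_le_D1[OF L[unfolded real_norm_def]]] .
  then have mem: "(l n, fun_of_mat d (\<sigma> n)) \<in> {0..L} \<times> fun_of_mat d ` F" for n
    using l by auto
  have "compact ({0..L} \<times> fun_of_mat d ` F)"
    by (intro compact_Times compact_fun_of_free_set[OF F]) simp
  then have "seq_compact ({0..L} \<times> fun_of_mat d ` F)"
    by (rule compact_imp_seq_compact)
  then obtain q r where q: "q \<in> {0..L} \<times> fun_of_mat d ` F" and r: "strict_mono r"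
    and lim: "((\<lambda>n. (l n, fun_of_mat d (\<sigma> n))) \<circ> r) \<longlonglongrightarrow> q"
    by (rule seq_compactE[of _ "\<lambda>n. (l n, fun_of_mat d (\<sigma> n))"]) (use mem in auto)
  from q obtain l' \<sigma>' where l': "q = (l', fun_of_mat d \<sigma>')" "0 \<le> l'" "\<sigma>' \<in> F" by auto
  have liml: "(\<lambda>n. l (r n)) \<longlonglongrightarrow> l'"
    using tendsto_fst[OF lim] by (simp add: l' o_def)
  have "(\<lambda>n. fun_of_mat d (\<sigma> (r n))) \<longlonglongrightarrow> fun_of_mat d \<sigma>'"
    using tendsto_snd[OF lim] by (simp add: l' o_def)
  then have lims: "(\<lambda>n. \<sigma> (r n) $$ (i, j)) \<longlonglongrightarrow> \<sigma>' $$ (i, j)" if "i < d" "j < d" for i j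
    using tendsto_coordinate[of _ "fun_of_mat d \<sigma>'" _ "(i, j)"] that by (fastforce simp: fun_of_mat_def)
  have "(\<lambda>n. X (r n)) \<longlonglongrightarrow> g"
    using LIMSEQ_subseq_LIMSEQ[OF g r] by (simp add: o_def)
  note limX = tendsto_coordinate[OF this]
  have "psdf d (\<lambda>x. complex_of_real l' * \<sigma>' $$ x - g (False, x))"
    by (rule psdf_limit[where f = "\<lambda>n x. complex_of_real (l (r n)) * \<sigma> (r n) $$ x - X (r n) (False, x)", OF l(3)])
      (intro tendsto_intros liml lims limX)
  moreover have "psdf d (\<lambda>x. g (True, x) - complex_of_real l' * \<sigma>' $$ x)"
    by (rule psdf_limit[where f = "\<lambda>n x. X (r n) (True, x) - complex_of_real (l (r n)) * \<sigma> (r n) $$ x", OF l(4)])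
      (intro tendsto_intros liml lims limX)
  moreover have "g (b, i, j) = 0" if "\<not> (i < d \<and> j < d)" for b i j
  proof -
    have "X n (b, i, j) = 0" for n using X that sandwich_cone_support by blast
    then show ?thesis using tendsto_coordinate[OF g, of "(b, i, j)"] by (simp add: LIMSEQ_const_iff)
  qed
  ultimately show "g \<in> sandwich_cone d F"
    using l' by (intro sandwich_coneI)
qed

text \<open>Convexity with weights \<open>l / (l + m)\<close> and \<open>m / (l + m)\<close>; if
  both multipliers are 0, any free state will do.\<close>

lemma free_set_cone_add:
  assumes F: "free_set d F" and \<sigma>: "\<sigma> \<in> F" "\<tau> \<in> F" and l: "0 \<le> l" "0 \<le> m"
  obtains \<upsilon> where "\<upsilon> \<in> F" "\<And>i j. i < d \<Longrightarrow> j < d \<Longrightarrow> complex_of_real (l + m) * \<upsilon> $$ (i, j)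
    = complex_of_real l * \<sigma> $$ (i, j) + complex_of_real m * \<tau> $$ (i, j)"
proof (cases "l + m = 0")
  case True
  then show ?thesis using that[OF \<sigma>(1)] l by (simp add: add_nonneg_eq_0_iff)
next
  case False
  define t where "t = l / (l + m)"
  have t: "0 \<le> t" "t \<le> 1" "(l + m) * t = l" "(l + m) * (1 - t) = m"
    using l False by (auto simp: t_def field_simps)
  let ?u = "complex_of_real t \<cdot>\<^sub>m \<sigma> + complex_of_real (1 - t) \<cdot>\<^sub>m \<tau>"
  have "?u \<in> F" using F \<sigma> t by (simp add: free_set_def mat_convex_def)
  moreover have "complex_of_real (l + m) * ?u $$ (i, j)
    = complex_of_real l * \<sigma> $$ (i, j) + complex_of_real m * \<tau> $$ (i, j)" if "i < d" "j < d" for i j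
  proof -
    have "\<sigma> \<in> carrier_mat d d" "\<tau> \<in> carrier_mat d d"
      using \<sigma> free_set_density[OF F] density_carrier by blast+
    then have "complex_of_real (l + m) * ?u $$ (i, j)
      = complex_of_real ((l + m) * t) * \<sigma> $$ (i, j) + complex_of_real ((l + m) * (1 - t)) * \<tau> $$ (i, j)"
      using that by (simp add: algebra_simps)
    then show ?thesis unfolding t .
  qed
  ultimately show ?thesis by (rule that)
qed

lemma sandwich_cone_add:
  assumes F: "free_set d F" and f: "f \<in> sandwich_cone d F" and g: "g \<in> sandwich_cone d F"
  shows "(\<lambda>x. f x + g x) \<in> sandwich_cone d F"
proof -
  obtain l \<sigma> where l: "0 \<le> l" "\<sigma> \<in> F" "psdf d (\<lambda>x. complex_of_real l * \<sigma> $$ x - f (False, x))"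
        "psdf d (\<lambda>x. f (True, x) - complex_of_real l * \<sigma> $$ x)"
    using f unfolding sandwich_cone_def by blast
  obtain m \<tau> where m: "0 \<le> m" "\<tau> \<in> F" "psdf d (\<lambda>x. complex_of_real m * \<tau> $$ x - g (False, x))"
        "psdf d (\<lambda>x. g (True, x) - complex_of_real m * \<tau> $$ x)"
    using g unfolding sandwich_cone_def by blast
  obtain \<upsilon> where u: "\<upsilon> \<in> F" "\<And>i j. i < d \<Longrightarrow> j < d \<Longrightarrow> complex_of_real (l + m) * \<upsilon> $$ (i, j)
    = complex_of_real l * \<sigma> $$ (i, j) + complex_of_real m * \<tau> $$ (i, j)"
    using free_set_cone_add[OF F l(2) m(2) l(1) m(1)] by blast
  have "psdf d (\<lambda>x. complex_of_real (l + m) * \<upsilon> $$ x - (f (False, x) + g (False, x)))"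
    using psdf_add[OF l(3) m(3)] by (rule psdf_cong[THEN iffD1, rotated]) (use u in \<open>simp add: algebra_simps\<close>)
  moreover have "psdf d (\<lambda>x. f (True, x) + g (True, x) - complex_of_real (l + m) * \<upsilon> $$ x)"
    using psdf_add[OF l(4) m(4)] by (rule psdf_cong[THEN iffD1, rotated]) (use u in \<open>simp add: algebra_simps\<close>)
  ultimately show ?thesis
    using sandwich_cone_support[OF f] sandwich_cone_support[OF g] u(1) l(1) m(1)
    by (intro sandwich_coneI[of d _ "l + m" \<upsilon>]) auto
qed

lemma sandwich_cone_scale:
  assumes f: "f \<in> sandwich_cone d F" and t: "0 \<le> t"
  shows "(\<lambda>x. t *\<^sub>R f x) \<in> sandwich_cone d F"
proof -
  obtain l \<sigma> where l: "0 \<le> l" "\<sigma> \<in> F" "psdf d (\<lambda>x. complex_of_real l * \<sigma> $$ x - f (False, x))"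
        "psdf d (\<lambda>x. f (True, x) - complex_of_real l * \<sigma> $$ x)"
    using f unfolding sandwich_cone_def by blast
  have "psdf d (\<lambda>x. complex_of_real (t * l) * \<sigma> $$ x - t *\<^sub>R f (False, x))"
    using psdf_scale[OF l(3) t] by (simp add: algebra_simps scaleR_conv_of_real)
  moreover have "psdf d (\<lambda>x. t *\<^sub>R f (True, x) - complex_of_real (t * l) * \<sigma> $$ x)"
    using psdf_scale[OF l(4) t] by (simp add: algebra_simps scaleR_conv_of_real)
  moreover have "0 \<le> t * l" using t l by simp
  ultimately show ?thesis
    using sandwich_cone_support[OF f] l(2) by (intro sandwich_coneI[of d _ "t * l" \<sigma>]) auto
qed

text \<open>Against a Hermitian matrix the anti-Hermitian part of \<open>y\<close> contributes
  nothing, so a real functional is a trace pairing with the Hermitian part of its coefficients. This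
  turns a separating vector into observables.\<close>

lemma inner_sum_hermitian:
  assumes "\<And>i j. i < d \<Longrightarrow> j < d \<Longrightarrow> cnj (f (i, j)) = f (j, i)"
  shows "(\<Sum>i<d. \<Sum>j<d. inner (y (i, j)) (f (i, j)))
    = Re (\<Sum>i<d. \<Sum>j<d. ((y (j, i) + cnj (y (i, j))) / 2) * f (i, j))"
proof -
  let ?S = "\<Sum>i<d. \<Sum>j<d. inner (y (i, j)) (f (i, j))"
  have inner: "inner a b = Re (cnj a * b)" for a b :: complex
    by (simp add: inner_complex_def)
  have S1: "(\<Sum>i<d. \<Sum>j<d. Re (cnj (y (i, j)) * f (i, j))) = ?S"
    unfolding inner ..
  have "(\<Sum>i<d. \<Sum>j<d. Re (y (j, i) * f (i, j))) = (\<Sum>j<d. \<Sum>i<d. Re (y (j, i) * f (i, j)))"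
    by (rule sum.swap)
  also have "\<dots> = (\<Sum>j<d. \<Sum>i<d. Re (cnj (y (j, i)) * f (j, i)))"
  proof (intro sum.cong refl)
    fix i j assume "i \<in> {..<d}" "j \<in> {..<d}"
    then have "f (j, i) = cnj (f (i, j))" using assms by simp
    then show "Re (y (j, i) * f (i, j)) = Re (cnj (y (j, i)) * f (j, i))" by simp
  qed
  finally have S2: "(\<Sum>i<d. \<Sum>j<d. Re (y (j, i) * f (i, j))) = ?S"
    using S1 by simp
  have "Re (\<Sum>i<d. \<Sum>j<d. ((y (j, i) + cnj (y (i, j))) / 2) * f (i, j))
    = (\<Sum>i<d. \<Sum>j<d. Re (y (j, i) * f (i, j)) / 2 + Re (cnj (y (i, j)) * f (i, j)) / 2)"
    unfolding Re_sum by (intro sum.cong refl) (simp add: field_simps)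
  also have "\<dots> = ?S / 2 + ?S / 2"
    by (simp only: sum.distrib sum_divide_distrib[symmetric] S1 S2)
  finally show ?thesis by simp
qed

definition embed_pair :: "nat \<Rightarrow> (bool \<Rightarrow> nat \<times> nat \<Rightarrow> complex) \<Rightarrow> bool \<times> nat \<times> nat \<Rightarrow> complex" where
  "embed_pair d G = (\<lambda>(b, i, j). if i < d \<and> j < d then G b (i, j) else 0)"

lemma embed_pair_mem_sandwich_cone_iff:
  "embed_pair d G \<in> sandwich_cone d F \<longleftrightarrow> (\<exists>l \<sigma>. 0 \<le> l \<and> \<sigma> \<in> F
    \<and> psdf d (\<lambda>x. complex_of_real l * \<sigma> $$ x - G False x)
    \<and> psdf d (\<lambda>x. G True x - complex_of_real l * \<sigma> $$ x))"
proof -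
  have "psdf d (\<lambda>x. c * \<sigma> $$ x - embed_pair d G (False, x)) \<longleftrightarrow> psdf d (\<lambda>x. c * \<sigma> $$ x - G False x)" for c \<sigma>
    by (rule psdf_cong) (simp add: embed_pair_def)
  moreover have "psdf d (\<lambda>x. embed_pair d G (True, x) - c * \<sigma> $$ x) \<longleftrightarrow> psdf d (\<lambda>x. G True x - c * \<sigma> $$ x)" for c \<sigma>
    by (rule psdf_cong) (simp add: embed_pair_def)
  moreover have "\<forall>b i j. \<not> (i < d \<and> j < d) \<longrightarrow> embed_pair d G (b, i, j) = 0"
    by (simp add: embed_pair_def)
  ultimately show ?thesis unfolding sandwich_cone_def by simp
qed

section \<open>Dual witnesses obtained from the separating functional\<close>

lemma psdf_zero: "psdf d (\<lambda>x. 0)"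
  by (rule psdfI) (auto simp: bform_def)

lemma trace_prod_one:
  assumes "X \<in> carrier_mat d d"
  shows "trace_prod d (1\<^sub>m d) X = mtrace X"
proof -
  have "trace_prod d (1\<^sub>m d) X = (\<Sum>i<d. \<Sum>j<d. if j = i then X $$ (i, j) else 0)"
    unfolding trace_prod_def by (intro sum.cong refl) auto
  then show ?thesis using assms by (simp add: mtrace_def)
qed

lemma psd_one: "psd d (1\<^sub>m d)"
proof -
  have "bform d (($$) (1\<^sub>m d)) v v = (\<Sum>i<d. cnj (v i) * v i)" for v
  proof -
    have "bform d (($$) (1\<^sub>m d)) v v = (\<Sum>i<d. \<Sum>j<d. if j = i then cnj (v i) * v j else 0)"
      unfolding bform_def by (intro sum.cong refl) auto
    then show ?thesis by simp
  qed
  then have "psdf d (($$) (1\<^sub>m d :: complex mat))"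
    by (intro psdfI) (auto intro!: sum_nonneg)
  then show ?thesis by (simp add: psd_iff_psdf)
qed

lemma psd_add:
  assumes "psd d A" "psd d B"
  shows "psd d (A + B)"
proof -
  have "A \<in> carrier_mat d d" "B \<in> carrier_mat d d" using assms by (auto simp: psd_def)
  then show ?thesis
    using psdf_add[of d "($$) A" "($$) B"] psdf_cong[of d "($$) (A + B)" "\<lambda>x. A $$ x + B $$ x"] assms
    by (auto simp: psd_iff_psdf)
qed

lemma trace_prod_add_left:
  "A \<in> carrier_mat d d \<Longrightarrow> B \<in> carrier_mat d d \<Longrightarrow> trace_prod d (A + B) X = trace_prod d A X + trace_prod d B X"
  by (simp add: trace_prod_def sum.distrib[symmetric] algebra_simps)

lemma trace_prod_smult_left: "A \<in> carrier_mat d d \<Longrightarrow> trace_prod d (c \<cdot>\<^sub>m A) X = c * trace_prod d A X"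
  by (simp add: trace_prod_def sum_distrib_left algebra_simps)

text \<open>By \<open>OmegaF_le\<close> the pair of \<open>\<rho>\<close> and
  \<open>t \<rho>\<close> lies outside the sandwich cone. The separating functional sends
  \<open>(x, y)\<close> to \<open>tr (B y) - tr (A x)\<close>; its nonnegativity on suitable pairs
  of the cone gives the properties of \<open>A\<close> and \<open>B\<close>, and its negativity at
  the excluded pair gives the strict inequality.\<close>

lemma OmegaF_dual_separation:
  assumes F: "free_set d F" and \<rho>: "density d \<rho>" and t: "ereal t < OmegaF d F \<rho>"
  obtains A B where "psd d A" "psd d B" "\<And>\<sigma>. \<sigma> \<in> F \<Longrightarrow> Re (trace_prod d A \<sigma>) \<le> Re (trace_prod d B \<sigma>)"
    "t * Re (trace_prod d B \<rho>) < Re (trace_prod d A \<rho>)"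
proof -
  let ?I = "UNIV \<times> {..<d} \<times> {..<d} :: (bool \<times> nat \<times> nat) set"
  let ?C = "sandwich_cone d F"
  let ?x = "embed_pair d (\<lambda>b x. if b then complex_of_real t * \<rho> $$ x else \<rho> $$ x)"
  obtain \<sigma>0 where \<sigma>0: "\<sigma>0 \<in> F" using F by (auto simp: free_set_def)
  have zero: "(\<lambda>_. 0) \<in> ?C"
    by (rule sandwich_coneI[of d _ 0 \<sigma>0]) (auto simp: \<sigma>0 psdf_zero)
  have x: "?x \<notin> ?C"
  proof
    assume "?x \<in> ?C"
    then obtain l \<sigma> where l: "\<sigma> \<in> F" "psdf d (\<lambda>x. complex_of_real l * \<sigma> $$ x - \<rho> $$ x)"
        "psdf d (\<lambda>x. complex_of_real t * \<rho> $$ x - complex_of_real l * \<sigma> $$ x)"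
      by (auto simp: embed_pair_mem_sandwich_cone_iff)
    then show False using OmegaF_le[OF F \<rho> l] t by simp
  qed
  have fin: "finite ?I" by simp
  have supp: "f i = 0" if "f \<in> ?C" "i \<notin> ?I" for f i
    using sandwich_cone_support[OF that(1)] that(2) by (cases i) auto
  have xsupp: "?x i = 0" if "i \<notin> ?I" for i
    using that by (cases i) (auto simp: embed_pair_def)
  obtain y where y: "\<And>z. z \<in> ?C \<Longrightarrow> 0 \<le> fdot ?I y z" "fdot ?I y ?x < 0"
  proof (rule closed_cone_separation[of ?I ?C ?x])
    show "closed ?C" by (rule closed_sandwich_cone[OF F])
    show "(\<lambda>i. f i + g i) \<in> ?C" if "f \<in> ?C" "g \<in> ?C" for f g
      using F that by (rule sandwich_cone_add)
    show "(\<lambda>i. t *\<^sub>R f i) \<in> ?C" if "f \<in> ?C" "0 \<le> t" for f t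
      using that by (rule sandwich_cone_scale)
  qed (rule fin, rule zero, erule supp, assumption, rule x, erule xsupp, blast)
  \<comment> \<open>The Hermitian parts of the two components of the separating vector.\<close>
  define H where "H b = mat d d (\<lambda>(i, j). (y (b, i, j) + cnj (y (b, j, i))) / 2)" for b
  have dot: "fdot ?I y (embed_pair d G) = Re (\<Sum>i<d. \<Sum>j<d. H False $$ (j, i) * G False (i, j))
      + Re (\<Sum>i<d. \<Sum>j<d. H True $$ (j, i) * G True (i, j))"
    if G: "\<And>b i j. i < d \<Longrightarrow> j < d \<Longrightarrow> cnj (G b (i, j)) = G b (j, i)" for G
  proof -
    have *: "(\<Sum>i<d. \<Sum>j<d. inner (y (b, i, j)) (G b (i, j)))
      = Re (\<Sum>i<d. \<Sum>j<d. H b $$ (j, i) * G b (i, j))" for b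
    proof -
      have "(\<Sum>i<d. \<Sum>j<d. inner (y (b, i, j)) (G b (i, j)))
        = Re (\<Sum>i<d. \<Sum>j<d. ((y (b, j, i) + cnj (y (b, i, j))) / 2) * G b (i, j))"
        using inner_sum_hermitian[of d "G b" "\<lambda>x. y (b, x)"] G by blast
      also have "\<dots> = Re (\<Sum>i<d. \<Sum>j<d. H b $$ (j, i) * G b (i, j))"
        by (intro arg_cong[where f = Re] sum.cong refl) (simp add: H_def)
      finally show ?thesis .
    qed
    have "fdot ?I y (embed_pair d G) = (\<Sum>b\<in>UNIV. \<Sum>x\<in>{..<d} \<times> {..<d}. inner (y (b, x)) (embed_pair d G (b, x)))"
      unfolding fdot_def by (subst sum.cartesian_product) (simp add: case_prod_beta)
    also have "\<dots> = (\<Sum>b\<in>UNIV. \<Sum>i<d. \<Sum>j<d. inner (y (b, i, j)) (G b (i, j)))"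
      by (rule sum.cong[OF refl], subst sum.cartesian_product) (auto simp: embed_pair_def intro!: sum.cong)
    finally show ?thesis by (simp add: UNIV_bool *)
  qed
  \<comment> \<open>The sign is reversed because lowering the lower component stays in the
    cone.\<close>
  define A where "A = mat d d (\<lambda>x. - H False $$ x)"
  have Hc: "cnj (H b $$ (i, j)) = H b $$ (j, i)" if "i < d" "j < d" for b i j
    using that by (simp add: H_def add.commute)
  have swap: "(\<Sum>i<d. \<Sum>j<d. K (j, i) * (v i * cnj (v j))) = bform d K v v" for K v
    unfolding bform_def by (subst sum.swap, intro sum.cong refl) (simp add: algebra_simps)
  have A: "psd d A"
  proof -
    have "psdf d (($$) A)"
    proof (rule psdfI)
      fix i j assume "i < d" "j < d"
      then show "cnj (A $$ (i, j)) = A $$ (j, i)" by (simp add: A_def Hc)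
    next
      fix v :: "nat \<Rightarrow> complex"
      \<comment> \<open>Lower component minus the rank-one matrix of \<open>v\<close>, upper
        component 0, and the free multiple 0 in between.\<close>
      let ?G = "\<lambda>b x. if b then 0 else - (case x of (i, j) \<Rightarrow> v i * cnj (v j))"
      have "embed_pair d ?G \<in> ?C"
        unfolding embed_pair_mem_sandwich_cone_iff
        by (intro exI[of _ 0] exI[of _ \<sigma>0]) (use psdf_rank_one[of d v] in \<open>simp add: \<sigma>0 psdf_zero\<close>)
      from y(1)[OF this] have "0 \<le> Re (\<Sum>i<d. \<Sum>j<d. H False $$ (j, i) * - (v i * cnj (v j)))"
        by (subst (asm) dot) auto
      also have "(\<Sum>i<d. \<Sum>j<d. H False $$ (j, i) * - (v i * cnj (v j)))
        = (\<Sum>i<d. \<Sum>j<d. A $$ (j, i) * (v i * cnj (v j)))"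
        by (intro sum.cong refl) (simp add: A_def)
      finally show "0 \<le> Re (bform d (($$) A) v v)" unfolding swap .
    qed
    then show ?thesis by (simp add: psd_iff_psdf A_def)
  qed
  have B: "psd d (H True)"
  proof -
    have "psdf d (($$) (H True))"
    proof (rule psdfI)
      fix v :: "nat \<Rightarrow> complex"
      let ?G = "\<lambda>b x. if b then (case x of (i, j) \<Rightarrow> v i * cnj (v j)) else 0"
      have "embed_pair d ?G \<in> ?C"
        unfolding embed_pair_mem_sandwich_cone_iff
        by (intro exI[of _ 0] exI[of _ \<sigma>0]) (use psdf_rank_one[of d v] in \<open>simp add: \<sigma>0 psdf_zero\<close>)
      from y(1)[OF this] have "0 \<le> Re (\<Sum>i<d. \<Sum>j<d. H True $$ (j, i) * (v i * cnj (v j)))"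
        by (subst (asm) dot) auto
      then show "0 \<le> Re (bform d (($$) (H True)) v v)" unfolding swap .
    qed (rule Hc)
    then show ?thesis by (simp add: psd_iff_psdf H_def)
  qed
  have AH: "Re (\<Sum>i<d. \<Sum>j<d. H False $$ (j, i) * X $$ (i, j)) = - Re (trace_prod d A X)" for X
  proof -
    have "trace_prod d A X = (\<Sum>i<d. \<Sum>j<d. - (H False $$ (j, i) * X $$ (i, j)))"
      unfolding trace_prod_def by (intro sum.cong refl) (simp add: A_def)
    then show ?thesis by (simp add: sum_negf)
  qed
  have herm: "cnj (X $$ (i, j)) = X $$ (j, i)" if "density d X" "i < d" "j < d" for X i j
    using psdf_cnj[of d "($$) X"] that by (simp add: density_def psd_iff_psdf)
  have "Re (trace_prod d A \<sigma>) \<le> Re (trace_prod d (H True) \<sigma>)" if \<sigma>: "\<sigma> \<in> F" for \<sigma>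
  proof -
    \<comment> \<open>Both components equal \<open>\<sigma>\<close>, which is itself the free
      element in between.\<close>
    have "embed_pair d (\<lambda>b x. \<sigma> $$ x) \<in> ?C"
      unfolding embed_pair_mem_sandwich_cone_iff
      by (intro exI[of _ 1] exI[of _ \<sigma>]) (simp add: \<sigma> psdf_zero)
    from y(1)[OF this] show ?thesis
      by (subst (asm) dot) (use herm[OF free_set_density[OF F \<sigma>]] AH[of \<sigma>] in \<open>auto simp: trace_prod_def\<close>)
  qed
  moreover have "t * Re (trace_prod d (H True) \<rho>) < Re (trace_prod d A \<rho>)"
  proof -
    have "(\<Sum>i<d. \<Sum>j<d. H True $$ (j, i) * (complex_of_real t * \<rho> $$ (i, j)))
      = complex_of_real t * trace_prod d (H True) \<rho>"
      by (simp add: trace_prod_def sum_distrib_left algebra_simps)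
    then show ?thesis
      using y(2) by (subst (asm) dot) (use herm[OF \<rho>] AH[of \<rho>] in auto)
  qed
  ultimately show thesis using that[OF A B] by blast
qed

text \<open>A positive multiple of the identity added to \<open>B\<close> preserves positivity and
  the inequality on free states. The right multiple turns the strict inequality at
  \<open>\<rho>\<close> into an equality, and it makes the denominator \<open>tr (B \<rho>)\<close>
  strictly positive.\<close>

lemma OmegaF_dual:
  assumes F: "free_set d F" and \<rho>: "density d \<rho>" and t: "ereal t < OmegaF d F \<rho>" "0 < t"
  obtains A B where "psd d A" "psd d B" "\<And>\<sigma>. \<sigma> \<in> F \<Longrightarrow> Re (trace_prod d A \<sigma>) \<le> Re (trace_prod d B \<sigma>)"
    "Re (trace_prod d A \<rho>) = t * Re (trace_prod d B \<rho>)" "0 < Re (trace_prod d B \<rho>)"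
proof -
  obtain A B where AB: "psd d A" "psd d B" "\<And>\<sigma>. \<sigma> \<in> F \<Longrightarrow> Re (trace_prod d A \<sigma>) \<le> Re (trace_prod d B \<sigma>)"
    "t * Re (trace_prod d B \<rho>) < Re (trace_prod d A \<rho>)"
    using OmegaF_dual_separation[OF F \<rho> t(1)] by blast
  define e where "e = Re (trace_prod d A \<rho>) / t - Re (trace_prod d B \<rho>)"
  have e: "0 < e" using AB(4) t(2) by (simp add: e_def field_simps)
  define B' where "B' = B + complex_of_real e \<cdot>\<^sub>m 1\<^sub>m d"
  have "B \<in> carrier_mat d d" using AB(2) by (simp add: psd_def)
  then have tr: "Re (trace_prod d B' X) = Re (trace_prod d B X) + e" if "density d X" for X
    using that density_carrier[OF that]
    by (simp add: B'_def trace_prod_add_left trace_prod_smult_left trace_prod_one density_def)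
  show thesis
  proof (rule that[OF AB(1)])
    show "psd d B'" unfolding B'_def using AB(2) e by (intro psd_add psd_smult psd_one) auto
    show "Re (trace_prod d A \<sigma>) \<le> Re (trace_prod d B' \<sigma>)" if "\<sigma> \<in> F" for \<sigma>
      using AB(3)[OF that] e tr[OF free_set_density[OF F that]] by simp
    show "Re (trace_prod d A \<rho>) = t * Re (trace_prod d B' \<rho>)"
      using t(2) by (simp add: tr[OF \<rho>] e_def field_simps)
    have "0 \<le> Re (trace_prod d B \<rho>)"
      using trace_prod_psd_real_nonneg(2)[OF AB(2)] \<rho> by (simp add: density_def)
    then show "0 < Re (trace_prod d B' \<rho>)" using e by (simp add: tr[OF \<rho>])
  qed
qed

section \<open>Infinite robustness and common null vectors\<close>

text \<open>Along \<open>w + s n\<close> the form is affine in the real parameter \<open>s\<close>;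
  being nonnegative for all \<open>s\<close>, it has slope 0.\<close>

lemma psdf_null_add:
  assumes f: "psdf d f" and n: "Re (bform d f n n) = 0"
  shows "Re (bform d f (\<lambda>i. w i + n i) (\<lambda>i. w i + n i)) = Re (bform d f w w)"
proof -
  define c where "c = 2 * Re (bform d f w n)"
  have "bform d f n w = cnj (bform d f w n)" using cnj_bform[OF f] by simp
  then have exp: "Re (bform d f (\<lambda>i. w i + complex_of_real s * n i) (\<lambda>i. w i + complex_of_real s * n i))
    = Re (bform d f w w) + s * c" for s
    unfolding bform_add_left bform_add_right bform_scale_left bform_scale_right
    using n by (simp add: c_def)
  have "c = 0"
  proof (rule ccontr)
    assume "c \<noteq> 0"
    \<comment> \<open>At the chosen parameter the affine function would take the value -1.\<close>
    then show False
      using psdf_nonneg[OF f, of "\<lambda>i. w i + complex_of_real (- (Re (bform d f w w) + 1) / c) * n i"]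
      unfolding exp by simp
  qed
  then show ?thesis using exp[of 1] by simp
qed

lemma Re_bform_scaleR: "Re (bform d f (\<lambda>i. t *\<^sub>R v i) (\<lambda>i. t *\<^sub>R v i)) = t\<^sup>2 * Re (bform d f v v)"
  unfolding scaleR_conv_of_real bform_scale_left bform_scale_right by (simp add: power2_eq_square)

lemma bform_cong_vec:
  "(\<And>i. i < d \<Longrightarrow> u i = u' i) \<Longrightarrow> (\<And>i. i < d \<Longrightarrow> v i = v' i) \<Longrightarrow> bform d f u v = bform d f u' v'"
  unfolding bform_def by (intro sum.cong) auto

lemma continuous_on_bform [continuous_intros]: "continuous_on S (\<lambda>v. Re (bform d f v v))"
  unfolding bform_def by (intro continuous_intros)

text \<open>Since the forms are nonnegative, the average of two free states is positive wherever one
  of them is. This condenses a finite subcover into a single free state.\<close>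

lemma free_set_common_positive:
  assumes F: "free_set d F" and "finite D" "D \<subseteq> F"
  shows "\<exists>\<tau>\<in>F. \<forall>w. (\<exists>\<sigma>\<in>D. 0 < Re (bform d (($$) \<sigma>) w w)) \<longrightarrow> 0 < Re (bform d (($$) \<tau>) w w)"
  using assms(2,3)
proof (induction D rule: finite_induct)
  case empty
  then show ?case using F by (auto simp: free_set_def)
next
  case (insert \<sigma> D)
  then obtain \<tau> where \<tau>: "\<tau> \<in> F"
    "\<And>w. (\<exists>\<sigma>\<in>D. 0 < Re (bform d (($$) \<sigma>) w w)) \<Longrightarrow> 0 < Re (bform d (($$) \<tau>) w w)"
    by auto
  obtain \<upsilon> where u: "\<upsilon> \<in> F" "\<And>i j. i < d \<Longrightarrow> j < d \<Longrightarrow> complex_of_real (1/2 + 1/2) * \<upsilon> $$ (i, j)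
    = complex_of_real (1/2) * \<sigma> $$ (i, j) + complex_of_real (1/2) * \<tau> $$ (i, j)"
    using free_set_cone_add[OF F _ \<tau>(1), of \<sigma> "1/2" "1/2"] insert.prems by auto
  have "bform d (($$) \<upsilon>) w w
    = complex_of_real (1/2) * bform d (($$) \<sigma>) w w + complex_of_real (1/2) * bform d (($$) \<tau>) w w" for w
    unfolding bform_scale_mat[symmetric] bform_add_mat[symmetric]
    by (rule bform_cong) (use u(2) in simp)
  then have "Re (bform d (($$) \<upsilon>) w w) = (Re (bform d (($$) \<sigma>) w w) + Re (bform d (($$) \<tau>) w w)) / 2" for w
    by simp
  note half = this
  have nonneg: "0 \<le> Re (bform d (($$) \<sigma>) w w)" "0 \<le> Re (bform d (($$) \<tau>) w w)" for w
    using insert.prems \<tau>(1) free_set_density[OF F] psdf_nonneg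
    by (auto simp: density_def psd_iff_psdf)
  have "0 < Re (bform d (($$) \<upsilon>) w w)"
    if "\<exists>\<sigma>\<in>insert \<sigma> D. 0 < Re (bform d (($$) \<sigma>) w w)" for w
  proof -
    have "0 < Re (bform d (($$) \<sigma>) w w) \<or> 0 < Re (bform d (($$) \<tau>) w w)"
      using that \<tau>(2)[of w] by auto
    then show ?thesis
      unfolding half using nonneg[of w] by (auto intro: add_pos_nonneg add_nonneg_pos)
  qed
  then show ?case using u(1) by blast
qed

text \<open>If every vector annihilated by all free states is also annihilated by \<open>\<rho>\<close>, then on the
  compact unit sphere of the orthogonal complement of the common null space some free state is
  bounded below, hence dominates \<open>\<rho>\<close> up to a factor.\<close>

lemma RF_infinite_null_vector:
  assumes F: "free_set d F" and \<rho>: "density d \<rho>" and inf: "RF d F \<rho> = \<infinity>"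
  obtains v where "\<And>\<sigma>. \<sigma> \<in> F \<Longrightarrow> Re (bform d (($$) \<sigma>) v v) = 0" "0 < Re (bform d (($$) \<rho>) v v)"
proof (rule ccontr)
  assume contra: "\<not> thesis"
  note witness = that
  define q where "q \<sigma> v = Re (bform d (($$) \<sigma>) v v)" for \<sigma> :: "complex mat" and v
  have [continuous_intros]: "continuous_on S (q \<sigma>)" for S \<sigma>
    unfolding q_def[abs_def] by (rule continuous_on_bform)
  have psd\<rho>: "psdf d (($$) \<rho>)" using \<rho> by (simp add: density_def psd_iff_psdf)
  have psdF: "psdf d (($$) \<sigma>)" if "\<sigma> \<in> F" for \<sigma>
    using free_set_density[OF F that] by (simp add: density_def psd_iff_psdf)
  have q\<rho>: "0 \<le> q \<rho> v" for v unfolding q_def by (rule psdf_nonneg[OF psd\<rho>])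
  have qF: "0 \<le> q \<sigma> v" if "\<sigma> \<in> F" for \<sigma> v unfolding q_def by (rule psdf_nonneg[OF psdF[OF that]])
  have null: "q \<rho> v = 0" if "\<And>\<sigma>. \<sigma> \<in> F \<Longrightarrow> q \<sigma> v = 0" for v
  proof (rule ccontr)
    assume "q \<rho> v \<noteq> 0"
    then have "0 < q \<rho> v" using q\<rho>[of v] by simp
    then show False using contra witness[of v] that unfolding q_def by blast
  qed
  have scale: "q \<sigma> (\<lambda>i. t *\<^sub>R v i) = t\<^sup>2 * q \<sigma> v" for \<sigma> t v
    unfolding q_def by (rule Re_bform_scaleR)
  have add: "q \<sigma> (\<lambda>i. w i + n i) = q \<sigma> w" if "psdf d (($$) \<sigma>)" "q \<sigma> n = 0" for \<sigma> w n
    using psdf_null_add[OF that(1)] that(2) by (simp add: q_def)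
  let ?I = "{..<d}"
  \<comment> \<open>The common null space of the free states; it is a subspace by
    \<open>psdf_null_add\<close>.\<close>
  define N where "N = {v. (\<forall>i. i \<notin> ?I \<longrightarrow> v i = 0) \<and> (\<forall>\<sigma>. \<sigma> \<in> F \<longrightarrow> q \<sigma> v = 0)}"
  have N_add: "(\<lambda>i. v i + w i) \<in> N" if "v \<in> N" "w \<in> N" for v w
    using that by (simp add: N_def add psdF)
  have N_scale: "(\<lambda>i. t *\<^sub>R v i) \<in> N" if "v \<in> N" for v t
    using that by (simp add: N_def scale)
  have N_zero: "(\<lambda>_. 0) \<in> N" by (simp add: N_def q_def bform_def)
  have N_conv: "(\<lambda>i. v i + t *\<^sub>R (w i - v i)) \<in> N" if "v \<in> N" "w \<in> N" for v w t
    using N_add[OF that(1) N_scale[OF N_add[OF that(2) N_scale[OF that(1), of "-1"]], of t]] by simp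
  have N_closed: "closed N"
    unfolding N_def
    by (intro closed_Collect_conj closed_Collect_all closed_Collect_imp closed_Collect_eq
        open_Collect_const continuous_intros)
  define T where "T = {w. (\<forall>i. i \<notin> ?I \<longrightarrow> w i = 0) \<and> fdot ?I w w = 1 \<and> (\<forall>n. n \<in> N \<longrightarrow> fdot ?I w n = 0)}"
  have "closed T"
    unfolding T_def fdot_def
    by (intro closed_Collect_conj closed_Collect_all closed_Collect_imp closed_Collect_eq
        open_Collect_const continuous_intros)
  moreover have "T \<subseteq> {f. (\<forall>i\<in>?I. norm (f i) \<le> 1) \<and> (\<forall>i. i \<notin> ?I \<longrightarrow> f i = 0)}"
  proof
    fix w assume w: "w \<in> T"
    then have "norm (w i) \<le> 1" if "i \<in> ?I" for i
      using norm_coord_le_fdot[of ?I i w] that by (simp add: T_def)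
    then show "w \<in> {f. (\<forall>i\<in>?I. norm (f i) \<le> 1) \<and> (\<forall>i. i \<notin> ?I \<longrightarrow> f i = 0)}"
      using w by (simp add: T_def)
  qed
  ultimately have T: "compact T"
    using compact_Int_closed[OF compact_supported_box[of ?I 1], of T] by (simp only: Int_absorb1)
  \<comment> \<open>A unit vector orthogonal to \<open>N\<close> cannot lie in \<open>N\<close>, so
    some free state is positive on it.\<close>
  have cover: "T \<subseteq> (\<Union>\<sigma>\<in>F. {w. 0 < q \<sigma> w})"
  proof
    fix w assume w: "w \<in> T"
    then have "w \<notin> N" by (auto simp: T_def)
    then obtain \<sigma> where "\<sigma> \<in> F" "q \<sigma> w \<noteq> 0" using w by (auto simp: N_def T_def)
    then show "w \<in> (\<Union>\<sigma>\<in>F. {w. 0 < q \<sigma> w})" using qF[of \<sigma> w] by force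
  qed
  have op: "open {w. 0 < q \<sigma> w}" for \<sigma>
    by (intro open_Collect_less continuous_intros)
  obtain D where D: "D \<subseteq> F" "finite D" "T \<subseteq> (\<Union>\<sigma>\<in>D. {w. 0 < q \<sigma> w})"
    by (rule compactE_image[OF T op cover])
  obtain \<tau> where \<tau>: "\<tau> \<in> F" "\<And>w. w \<in> T \<Longrightarrow> 0 < q \<tau> w"
    using free_set_common_positive[OF F D(2,1)] D(3) unfolding q_def by blast
  obtain l where l: "\<And>w. w \<in> T \<Longrightarrow> q \<rho> w \<le> l * q \<tau> w"
  proof (cases "T = {}")
    case True
    then show ?thesis using that[of 0] by simp
  next
    case False
    have "continuous_on T (\<lambda>w. q \<rho> w / q \<tau> w)"
      using \<tau>(2) by (intro continuous_intros) force
    from continuous_attains_sup[OF T False this]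
    obtain w0 where "\<And>w. w \<in> T \<Longrightarrow> q \<rho> w / q \<tau> w \<le> q \<rho> w0 / q \<tau> w0" by blast
    then show ?thesis using that[of "q \<rho> w0 / q \<tau> w0"] \<tau>(2) by (simp add: pos_divide_le_eq)
  qed
  \<comment> \<open>Subtract the projection \<open>n\<close> onto \<open>N\<close>: neither form
    notices it, and the remainder \<open>w\<close> is 0 or a multiple of a vector in
    \<open>T\<close>.\<close>
  have main: "q \<rho> v \<le> l * q \<tau> v" if supp: "\<And>i. i \<notin> ?I \<Longrightarrow> v i = 0" for v
  proof -
    obtain n where n: "n \<in> N" "\<And>z. z \<in> N \<Longrightarrow> fdot ?I (\<lambda>i. v i - n i) (\<lambda>i. z i - n i) \<le> 0"
      by (rule closest_point_supported[of ?I N v]) (use N_closed N_zero N_conv in \<open>auto simp: N_def\<close>)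
    define w where "w = (\<lambda>i. v i - n i)"
    \<comment> \<open>As \<open>N\<close> is a subspace, the variational inequality can be tested at
      both \<open>z + n\<close> and \<open>- z + n\<close>.\<close>
    have orth: "fdot ?I w z = 0" if "z \<in> N" for z
    proof -
      have "fdot ?I w z \<le> 0"
        using n(2)[OF N_add[OF that n(1)]] by (simp add: w_def)
      moreover have "fdot ?I w (\<lambda>i. (-1) *\<^sub>R z i) \<le> 0"
        using n(2)[OF N_add[OF N_scale[OF that, of "-1"] n(1)]] by (simp add: w_def)
      ultimately show ?thesis unfolding fdot_scaleR_right by simp
    qed
    have wsupp: "w i = 0" if "i \<notin> ?I" for i using that supp n(1) by (simp add: w_def N_def)
    have qn: "q \<tau> n = 0" "q \<rho> n = 0" using n(1) \<tau>(1) null[of n] by (auto simp: N_def)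
    have v: "v = (\<lambda>i. w i + n i)" by (simp add: w_def)
    have "q \<rho> w \<le> l * q \<tau> w"
    proof (cases "fdot ?I w w = 0")
      case True
      then have "w = (\<lambda>_. 0)" using wsupp fdot_self_eq_0_iff[of ?I w] by auto
      then show ?thesis by (simp add: q_def bform_def)
    next
      case False
      define s where "s = fdot ?I w w"
      have s: "s > 0" using False fdot_self_nonneg[of ?I w] by (simp add: s_def)
      define u where "u = (\<lambda>i. (1 / sqrt s) *\<^sub>R w i)"
      have us: "fdot ?I u z = fdot ?I w z / sqrt s" for z
        by (simp add: u_def fdot_def sum_divide_distrib)
      have "fdot ?I u u = 1"
        unfolding us unfolding u_def fdot_scaleR_right using s by (simp add: s_def[symmetric])
      then have "u \<in> T" unfolding T_def using wsupp orth by (simp add: us) (simp add: u_def)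
      from l[OF this] have "(1 / sqrt s)\<^sup>2 * q \<rho> w \<le> (1 / sqrt s)\<^sup>2 * (l * q \<tau> w)"
        unfolding u_def scale by (simp add: algebra_simps)
      then show ?thesis using s by (simp add: power_divide divide_le_cancel)
    qed
    then show ?thesis unfolding v using add[OF psd\<rho> qn(2)] add[OF psdF[OF \<tau>(1)] qn(1)] by simp
  qed
  have "psdf d (\<lambda>x. complex_of_real l * \<tau> $$ x - \<rho> $$ x)"
  proof (rule psdfI)
    fix i j assume "i < d" "j < d"
    then show "cnj (complex_of_real l * \<tau> $$ (i, j) - \<rho> $$ (i, j)) = complex_of_real l * \<tau> $$ (j, i) - \<rho> $$ (j, i)"
      using psdf_cnj[OF psd\<rho>] psdf_cnj[OF psdF[OF \<tau>(1)]] by simp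
  next
    fix v :: "nat \<Rightarrow> complex"
    define v' where "v' = (\<lambda>i. if i < d then v i else 0)"
    have "bform d f v v = bform d f v' v'" for f by (rule bform_cong_vec) (auto simp: v'_def)
    then show "0 \<le> Re (bform d (\<lambda>x. complex_of_real l * \<tau> $$ x - \<rho> $$ x) v v)"
      using main[of v'] by (simp add: bform_diff_mat bform_scale_mat q_def v'_def)
  qed
  then have "loewner_le d \<rho> (complex_of_real l \<cdot>\<^sub>m \<tau>)"
    using loewner_le_smult_iff[OF density_carrier[OF \<rho>] density_carrier[OF free_set_density[OF F \<tau>(1)]]] by simp
  from Rmax_le[OF this] have "RF d F \<rho> \<le> ereal l"
    unfolding RF_def using \<tau>(1) by (rule INF_lower2[rotated])
  then show False using inf by simp
qed

section \<open>Approximate transformations\<close>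

lemma cone_psd:
  assumes "free_set d F" "X \<in> Defs.cone F"
  shows "psd d X"
  using assms psd_smult free_set_density by (auto simp: Defs.cone_def density_def)

lemma cone_scale_memI: "\<sigma> \<in> F \<Longrightarrow> 0 \<le> l \<Longrightarrow> complex_of_real l \<cdot>\<^sub>m \<sigma> \<in> Defs.cone F"
  by (auto simp: Defs.cone_def)

lemma cone_add:
  assumes F: "free_set d F" and X: "X \<in> Defs.cone F" and Y: "Y \<in> Defs.cone F"
  shows "X + Y \<in> Defs.cone F"
proof -
  obtain l \<sigma> where l: "0 \<le> l" "\<sigma> \<in> F" "X = complex_of_real l \<cdot>\<^sub>m \<sigma>"
    using X by (auto simp: Defs.cone_def)
  obtain m \<tau> where m: "0 \<le> m" "\<tau> \<in> F" "Y = complex_of_real m \<cdot>\<^sub>m \<tau>"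
    using Y by (auto simp: Defs.cone_def)
  obtain \<upsilon> where u: "\<upsilon> \<in> F" "\<And>i j. i < d \<Longrightarrow> j < d \<Longrightarrow> complex_of_real (l + m) * \<upsilon> $$ (i, j)
    = complex_of_real l * \<sigma> $$ (i, j) + complex_of_real m * \<tau> $$ (i, j)"
    using free_set_cone_add[OF F l(2) m(2) l(1) m(1)] by blast
  have carr: "\<sigma> \<in> carrier_mat d d" "\<tau> \<in> carrier_mat d d" "\<upsilon> \<in> carrier_mat d d"
    using l m u free_set_density[OF F] density_carrier by blast+
  have "X + Y = complex_of_real (l + m) \<cdot>\<^sub>m \<upsilon>"
    unfolding l m using carr u(2) by (intro eq_matI) auto
  then show ?thesis using cone_scale_memI[OF u(1), of "l + m"] l(1) m(1) by simp
qed

lemma cone_scale: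
  assumes "X \<in> Defs.cone F" "0 \<le> c"
  shows "complex_of_real c \<cdot>\<^sub>m X \<in> Defs.cone F"
proof -
  obtain l \<sigma> where l: "0 \<le> l" "\<sigma> \<in> F" "X = complex_of_real l \<cdot>\<^sub>m \<sigma>"
    using assms by (auto simp: Defs.cone_def)
  have "complex_of_real c \<cdot>\<^sub>m X = complex_of_real (c * l) \<cdot>\<^sub>m \<sigma>"
    unfolding l by (intro eq_matI) auto
  then show ?thesis using cone_scale_memI[OF l(2), of "c * l"] l assms by simp
qed

text \<open>Write \<open>a P + b Q = a (P + Q) + (b - a) Q\<close> for outcome weights \<open>a \<le> b\<close>.\<close>

lemma measure_prepare_mem_cone:
  assumes F': "free_set d' F'" and A: "psd d A" and B: "psd d B" and \<sigma>: "density d \<sigma>"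
    and P: "P \<in> carrier_mat d' d'" and PQ: "P + Q \<in> Defs.cone F'" and Q: "Q \<in> Defs.cone F'"
    and le: "Re (trace_prod d A \<sigma>) \<le> Re (trace_prod d B \<sigma>)"
  shows "measure_prepare d A B P Q \<sigma> \<in> Defs.cone F'"
proof -
  define a b where "a = Re (trace_prod d A \<sigma>)" and "b = Re (trace_prod d B \<sigma>)"
  have "psd d \<sigma>" using \<sigma> by (simp add: density_def)
  then have ab: "trace_prod d A \<sigma> = complex_of_real a" "trace_prod d B \<sigma> = complex_of_real b" "0 \<le> a" "a \<le> b"
    using trace_prod_psd_real_nonneg[OF A] trace_prod_psd_real_nonneg[OF B] le by (auto simp: a_def b_def)
  have "Q \<in> carrier_mat d' d'" using cone_psd[OF F' Q] by (simp add: psd_def)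
  then have "measure_prepare d A B P Q \<sigma> = complex_of_real a \<cdot>\<^sub>m (P + Q) + complex_of_real (b - a) \<cdot>\<^sub>m Q"
    unfolding measure_prepare_def ab using P by (intro eq_matI) (auto simp: algebra_simps)
  then show ?thesis
    using ab by (simp only:) (intro cone_add[OF F'] cone_scale PQ Q; simp)
qed

text \<open>One fixed accuracy, and a map not yet trace-non-increasing:
  \<open>measure_prepare_free_op\<close> supplies the scaling, to which the normalised output is
  insensitive.\<close>

definition approximable :: "nat \<Rightarrow> complex mat set \<Rightarrow> nat \<Rightarrow> complex mat set \<Rightarrow>
    complex mat \<Rightarrow> complex mat \<Rightarrow> real \<Rightarrow> bool" where
  "approximable d F d' F' \<rho> \<rho>' e \<longleftrightarrow> (\<exists>A B P Q. psd d A \<and> psd d B \<and> psd d' P \<and> psd d' Q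
    \<and> (\<forall>\<sigma>\<in>F. measure_prepare d A B P Q \<sigma> \<in> Defs.cone F')
    \<and> 0 < Re (mtrace (measure_prepare d A B P Q \<rho>))
    \<and> (\<forall>i<d'. \<forall>j<d'. cmod (measure_prepare d A B P Q \<rho> $$ (i, j) / mtrace (measure_prepare d A B P Q \<rho>) - \<rho>' $$ (i, j)) < e))"

lemma prob_transformableI:
  assumes F: "free_set d F" and F': "free_set d' F'"
    and approx: "\<And>e. 0 < e \<Longrightarrow> approximable d F d' F' \<rho> \<rho>' e"
  shows "prob_transformable d F d' F' \<rho> \<rho>'"
  unfolding prob_transformable_def
proof (intro allI impI)
  fix e :: real assume "0 < e"
  then obtain A B P Q where psd: "psd d A" "psd d B" "psd d' P" "psd d' Q"
    and inv: "\<And>\<sigma>. \<sigma> \<in> F \<Longrightarrow> measure_prepare d A B P Q \<sigma> \<in> Defs.cone F'"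
    and pos: "0 < Re (mtrace (measure_prepare d A B P Q \<rho>))"
    and close: "\<And>i j. i < d' \<Longrightarrow> j < d' \<Longrightarrow>
      cmod (measure_prepare d A B P Q \<rho> $$ (i, j) / mtrace (measure_prepare d A B P Q \<rho>) - \<rho>' $$ (i, j)) < e"
    using approx[OF \<open>0 < e\<close>] unfolding approximable_def by blast
  obtain c E where c: "c > 0" and E: "E \<in> free_ops d F d' F'"
    and eq: "\<And>X. E X = complex_of_real c \<cdot>\<^sub>m measure_prepare d A B P Q X"
    using measure_prepare_free_op[OF F F' psd inv] by blast
  have carr: "measure_prepare d A B P Q \<rho> \<in> carrier_mat d' d'"
    using psd by (simp add: measure_prepare_def psd_def)
  have tr: "mtrace (E \<rho>) = complex_of_real c * mtrace (measure_prepare d A B P Q \<rho>)"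
    unfolding eq by (rule mtrace_smult[OF carr])
  have entry: "E \<rho> $$ (i, j) / mtrace (E \<rho>) = measure_prepare d A B P Q \<rho> $$ (i, j) / mtrace (measure_prepare d A B P Q \<rho>)"
    if "i < d'" "j < d'" for i j
    unfolding tr using carr c that by (simp add: eq)
  have "0 < Re (mtrace (E \<rho>))" using pos c by (simp add: tr)
  then show "\<exists>E\<in>free_ops d F d' F'. 0 < Re (mtrace (E \<rho>)) \<and>
      (\<forall>i<d'. \<forall>j<d'. cmod (E \<rho> $$ (i, j) / mtrace (E \<rho>) - \<rho>' $$ (i, j)) < e)"
    using E close entry by (intro bexI[of _ E]) auto
qed

lemma density_entry_le_1: "density d X \<Longrightarrow> i < d \<Longrightarrow> j < d \<Longrightarrow> norm (X $$ (i, j)) \<le> 1"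
  using psd_entry_le_trace[of d X i j] by (simp add: density_def)

text \<open>The normalised mixture differs from \<open>X\<close> by \<open>k / (s + k)\<close> times
  \<open>Y - X\<close>, whose entries have modulus at most 2.\<close>

lemma mix_close:
  assumes "density d X" "density d Y" "i < d" "j < d" and s: "0 < s" "0 \<le> k"
  shows "cmod ((complex_of_real s * X $$ (i, j) + complex_of_real k * Y $$ (i, j)) / complex_of_real (s + k)
    - X $$ (i, j)) \<le> 2 * k / s"
proof -
  have "(complex_of_real s * x + complex_of_real k * y) / complex_of_real (s + k) - x
    = complex_of_real (k / (s + k)) * (y - x)" for x y
  proof -
    have "complex_of_real s + complex_of_real k \<noteq> 0"
      using s by (simp flip: of_real_add)
    then show ?thesis by (simp add: field_simps)
  qed
  then have "cmod ((complex_of_real s * X $$ (i, j) + complex_of_real k * Y $$ (i, j)) / complex_of_real (s + k)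
    - X $$ (i, j)) = k / (s + k) * cmod (Y $$ (i, j) - X $$ (i, j))"
    using s by (simp add: norm_mult norm_divide del: of_real_add of_real_divide)
  also have "\<dots> \<le> k / s * 2"
  proof (intro mult_mono)
    show "k / (s + k) \<le> k / s" using s by (intro divide_left_mono) auto
    show "cmod (Y $$ (i, j) - X $$ (i, j)) \<le> 2"
      using norm_triangle_ineq4[of "Y $$ (i, j)" "X $$ (i, j)"]
        density_entry_le_1[OF assms(1,3,4)] density_entry_le_1[OF assms(2,3,4)] by simp
  qed (use s in auto)
  also have "k / s * 2 = 2 * k / s" by simp
  finally show ?thesis .
qed

text \<open>The common core of the two cases that use the dual witnesses. The output is a positive
  multiple of \<open>t P + Q\<close>, which \<open>mix\<close> rewrites as a mixture with weight
  \<open>t - 1\<close> on the target and a comparatively small weight \<open>k\<close> on a free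
  state.\<close>

lemma approximable_by_mixture:
  assumes F: "free_set d F" and F': "free_set d' F'" and \<rho>: "density d \<rho>" and \<rho>': "density d' \<rho>'"
    and t: "1 < t" "ereal t < OmegaF d F \<rho>"
    and P: "psd d' P" and Q: "Q \<in> Defs.cone F'" and PQ: "P + Q \<in> Defs.cone F'"
    and k: "0 \<le> k" and \<sigma>': "\<sigma>' \<in> F'"
    and mix: "\<And>i j. i < d' \<Longrightarrow> j < d' \<Longrightarrow> complex_of_real t * P $$ (i, j) + Q $$ (i, j)
      = complex_of_real (t - 1) * \<rho>' $$ (i, j) + complex_of_real k * \<sigma>' $$ (i, j)"
    and e: "2 * k / (t - 1) < e"
  shows "approximable d F d' F' \<rho> \<rho>' e"
proof -
  obtain A B where AB: "psd d A" "psd d B" "\<And>\<sigma>. \<sigma> \<in> F \<Longrightarrow> Re (trace_prod d A \<sigma>) \<le> Re (trace_prod d B \<sigma>)"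
    "Re (trace_prod d A \<rho>) = t * Re (trace_prod d B \<rho>)" "0 < Re (trace_prod d B \<rho>)"
    using OmegaF_dual[OF F \<rho> t(2)] t(1) by auto
  define b where "b = Re (trace_prod d B \<rho>)"
  have psd\<rho>: "psd d \<rho>" using \<rho> by (simp add: density_def)
  have tr: "trace_prod d A \<rho> = complex_of_real b * complex_of_real t" "trace_prod d B \<rho> = complex_of_real b" "0 < b"
    using trace_prod_psd_real_nonneg(1)[OF AB(1) psd\<rho>] trace_prod_psd_real_nonneg(1)[OF AB(2) psd\<rho>] AB(4,5)
    by (auto simp: b_def mult.commute)
  have d\<sigma>': "density d' \<sigma>'" using free_set_density[OF F' \<sigma>'] .
  have carr: "P \<in> carrier_mat d' d'" "Q \<in> carrier_mat d' d'" "\<rho>' \<in> carrier_mat d' d'" "\<sigma>' \<in> carrier_mat d' d'"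
    using P cone_psd[OF F' Q] density_carrier[OF \<rho>'] density_carrier[OF d\<sigma>'] by (auto simp: psd_def)
  let ?M = "measure_prepare d A B P Q \<rho>"
  have M: "?M $$ (i, j) = complex_of_real b * (complex_of_real (t - 1) * \<rho>' $$ (i, j) + complex_of_real k * \<sigma>' $$ (i, j))"
    if "i < d'" "j < d'" for i j
  proof -
    have "?M $$ (i, j) = complex_of_real b * (complex_of_real t * P $$ (i, j) + Q $$ (i, j))"
      unfolding measure_prepare_def tr using carr that by (simp add: algebra_simps)
    then show ?thesis unfolding mix[OF that] .
  qed
  have "?M = complex_of_real b \<cdot>\<^sub>m (complex_of_real (t - 1) \<cdot>\<^sub>m \<rho>' + complex_of_real k \<cdot>\<^sub>m \<sigma>')"
  proof (rule eq_matI)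
    fix i j assume "i < dim_row (complex_of_real b \<cdot>\<^sub>m (complex_of_real (t - 1) \<cdot>\<^sub>m \<rho>' + complex_of_real k \<cdot>\<^sub>m \<sigma>'))"
      "j < dim_col (complex_of_real b \<cdot>\<^sub>m (complex_of_real (t - 1) \<cdot>\<^sub>m \<rho>' + complex_of_real k \<cdot>\<^sub>m \<sigma>'))"
    then have "i < d'" "j < d'" using carr by auto
    then show "?M $$ (i, j) = (complex_of_real b \<cdot>\<^sub>m (complex_of_real (t - 1) \<cdot>\<^sub>m \<rho>' + complex_of_real k \<cdot>\<^sub>m \<sigma>')) $$ (i, j)"
      unfolding M[OF \<open>i < d'\<close> \<open>j < d'\<close>] using carr by simp
  qed (use carr in \<open>auto simp: measure_prepare_def\<close>)
  then have "mtrace ?M = complex_of_real b * (complex_of_real (t - 1) * mtrace \<rho>' + complex_of_real k * mtrace \<sigma>')"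
    using carr by (simp add: mtrace_smult[of _ d'] mtrace_add[of _ d'])
  then have trM: "mtrace ?M = complex_of_real b * complex_of_real (t - 1 + k)"
    using \<rho>' d\<sigma>' by (simp add: density_def)
  have "0 < Re (mtrace ?M)" using tr t k by (simp add: trM)
  moreover have "cmod (?M $$ (i, j) / mtrace ?M - \<rho>' $$ (i, j)) < e" if "i < d'" "j < d'" for i j
  proof -
    have "?M $$ (i, j) / mtrace ?M = (complex_of_real (t - 1) * \<rho>' $$ (i, j) + complex_of_real k * \<sigma>' $$ (i, j)) / complex_of_real (t - 1 + k)"
      unfolding trM M[OF that] using tr by simp
    then show ?thesis using mix_close[OF \<rho>' d\<sigma>' that, of "t - 1" k] t k e by simp
  qed
  moreover have "measure_prepare d A B P Q \<sigma> \<in> Defs.cone F'" if "\<sigma> \<in> F" for \<sigma>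
    using measure_prepare_mem_cone[OF F' AB(1,2) free_set_density[OF F that] carr(1) PQ Q AB(3)[OF that]] .
  ultimately show ?thesis
    unfolding approximable_def using AB(1,2) P cone_psd[OF F' Q] by blast
qed

section \<open>Multipliers extracted from the infima\<close>

lemma RmaxF_less_obtain:
  assumes "RmaxF d F X Y < c"
  obtains l where "ereal l < c" "free_le d F X (complex_of_real l \<cdot>\<^sub>m Y)"
  using assms unfolding RmaxF_def Inf_less_iff by blast

lemma Rmax_less_obtain:
  assumes "Rmax d X Y < c"
  obtains l where "ereal l < c" "loewner_le d X (complex_of_real l \<cdot>\<^sub>m Y)"
  using assms unfolding Rmax_def Inf_less_iff by blast

lemma free_le_imp_loewner_le: "free_set d F \<Longrightarrow> free_le d F X Y \<Longrightarrow> loewner_le d X Y"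
  by (simp add: free_le_def loewner_le_def cone_psd)

lemma free_le_density_ge_1:
  assumes "free_set d F" "density d X" "density d Y" "free_le d F X (complex_of_real l \<cdot>\<^sub>m Y)"
  shows "1 \<le> l"
  using loewner_le_density_ge_1[OF assms(2,3) free_le_imp_loewner_le[OF assms(1,4)]] .

lemma RmaxF_ge_1:
  assumes "free_set d F" "density d X" "density d Y"
  shows "1 \<le> RmaxF d F X Y"
  unfolding RmaxF_def using free_le_density_ge_1[OF assms] by (intro Inf_greatest) auto

text \<open>Factors that are at least 1 and have a finite product are finite, so both can be raised
  a little.\<close>

lemma ereal_mult_less_obtain:
  assumes a: "1 \<le> a" and b: "1 \<le> b" and ab: "a * b < ereal c"
  obtains x y where "a < ereal x" "b < ereal y" "x * y < c"
proof -
  have "0 < a" "0 < b" using a b by (auto intro: less_le_trans[of 0 1])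
  then have "a \<noteq> \<infinity>" "b \<noteq> \<infinity>" using ab by (auto split: if_splits)
  then obtain a' b' where ab': "a = ereal a'" "b = ereal b'" "1 \<le> a'" "1 \<le> b'" "a' * b' < c"
    using a b ab by (cases a; cases b) auto
  \<comment> \<open>Raising both factors by \<open>e\<close> adds \<open>e * (a' + b' + e)\<close>
    to the product; \<open>e \<le> 1\<close> keeps this strictly below
    \<open>e * (a' + b' + 2)\<close>, hence below the available slack.\<close>
  define e where "e = min 1 ((c - a' * b') / (a' + b' + 2))"
  have s: "0 < a' + b' + 2" using ab' by simp
  have "e \<le> (c - a' * b') / (a' + b' + 2)" unfolding e_def by (rule min.cobounded2)
  moreover have "0 < e" "e \<le> 1" using ab' s by (simp_all add: e_def)
  ultimately have e: "0 < e" "e \<le> 1" "e * (a' + b' + 2) \<le> c - a' * b'"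
    using s by (simp_all add: pos_le_divide_eq)
  have "(a' + e) * (b' + e) = a' * b' + e * (a' + b' + e)" by (simp add: algebra_simps)
  also have "\<dots> < a' * b' + e * (a' + b' + 2)" using e by simp
  also have "\<dots> \<le> c" using e by simp
  finally show thesis using that[of "a' + e" "b' + e"] e ab' by simp
qed

text \<open>The slack up to \<open>c\<close> replaces attainment of the infima: actual multipliers
  come out, both at least 1 by comparison of traces.\<close>

lemma OmegaFF_less_obtain:
  assumes F: "free_set d F" and \<rho>: "density d \<rho>" and c: "OmegaFF d F \<rho> < ereal c"
  obtains \<sigma> l m where "\<sigma> \<in> F" "1 \<le> l" "1 \<le> m" "l * m < c"
    "complex_of_real l \<cdot>\<^sub>m \<sigma> - \<rho> \<in> Defs.cone F" "loewner_le d \<sigma> (complex_of_real m \<cdot>\<^sub>m \<rho>)"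
proof -
  obtain \<sigma> where \<sigma>: "\<sigma> \<in> F" "RmaxF d F \<rho> \<sigma> * Rmax d \<sigma> \<rho> < ereal c"
    using c unfolding OmegaFF_def INF_less_iff by blast
  have d\<sigma>: "density d \<sigma>" using free_set_density[OF F \<sigma>(1)] .
  obtain x y where xy: "RmaxF d F \<rho> \<sigma> < ereal x" "Rmax d \<sigma> \<rho> < ereal y" "x * y < c"
    using ereal_mult_less_obtain[OF RmaxF_ge_1[OF F \<rho> d\<sigma>] Rmax_ge_1[OF d\<sigma> \<rho>] \<sigma>(2)] by blast
  obtain l where l: "l < x" "free_le d F \<rho> (complex_of_real l \<cdot>\<^sub>m \<sigma>)"
    using RmaxF_less_obtain[OF xy(1)] by auto
  obtain m where m: "m < y" "loewner_le d \<sigma> (complex_of_real m \<cdot>\<^sub>m \<rho>)"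
    using Rmax_less_obtain[OF xy(2)] by auto
  have l1: "1 \<le> l" using free_le_density_ge_1[OF F \<rho> d\<sigma> l(2)] .
  have m1: "1 \<le> m" using loewner_le_density_ge_1[OF d\<sigma> \<rho> m(2)] .
  have "l * m \<le> x * y" using l m l1 m1 by (intro mult_mono) auto
  then show thesis using that[OF \<sigma>(1) l1 m1 _ _ m(2)] l(2) xy(3) by (simp add: free_le_def)
qed

text \<open>Take \<open>t\<close> slightly below \<open>w\<close> and a product \<open>l * m\<close>
  slightly above it. The free state then enters with weight \<open>k = l - t / m < 2 * h\<close>,
  while \<open>1 < w\<close> keeps the weight \<open>t - 1\<close> of the target away from
  0.\<close>

lemma approximable_finite_Omega:
  assumes F: "free_set d F" and F': "free_set d' F'" and \<rho>: "density d \<rho>" and \<rho>': "density d' \<rho>'"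
    and w: "OmegaF d F \<rho> = ereal w" "1 < w" "OmegaFF d' F' \<rho>' \<le> ereal w" and e: "0 < e"
  shows "approximable d F d' F' \<rho> \<rho>' e"
proof -
  \<comment> \<open>The first bound ensures \<open>(w - 1) / 2 \<le> t - 1\<close>; the second makes
    \<open>2 * k\<close>, which is below \<open>4 * h\<close>, smaller than
    \<open>e * (t - 1)\<close>.\<close>
  define h where "h = min ((w - 1) / 2) (e * (w - 1) / 16)"
  define t where "t = w - h"
  have "0 < e * (w - 1)" using e w by simp
  then have "0 < h" using w by (simp add: h_def)
  moreover have "h \<le> (w - 1) / 2" unfolding h_def by (rule min.cobounded1)
  moreover have "h \<le> e * (w - 1) / 16" unfolding h_def by (rule min.cobounded2)
  ultimately have h: "0 < h" "h \<le> (w - 1) / 2" "h \<le> e * (w - 1) / 16" by blast+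
  then have t: "1 < t" "(w - 1) / 2 \<le> t - 1" using w by (auto simp: t_def field_simps)
  have "OmegaFF d' F' \<rho>' < ereal (w + h)"
    using w(3) h by (rule_tac order.strict_trans1) auto
  then obtain \<sigma>' l0 m where s: "\<sigma>' \<in> F'" "1 \<le> l0" "1 \<le> m" "l0 * m < w + h"
    "complex_of_real l0 \<cdot>\<^sub>m \<sigma>' - \<rho>' \<in> Defs.cone F'" "loewner_le d' \<sigma>' (complex_of_real m \<cdot>\<^sub>m \<rho>')"
    by (rule OmegaFF_less_obtain[OF F' \<rho>'])
  note d\<sigma>' = free_set_density[OF F' s(1)]
  note carr = density_carrier[OF \<rho>'] density_carrier[OF d\<sigma>']
  \<comment> \<open>Enlarging \<open>l0\<close> if necessary makes \<open>k\<close> nonnegative. It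
    only adds a free multiple of \<open>\<sigma>'\<close> to \<open>Q\<close>, and
    \<open>l * m\<close> stays below \<open>w + h\<close> because \<open>t\<close> does.\<close>
  define l where "l = max l0 (t / m)"
  have lm: "t \<le> l * m" "l * m < w + h"
    using s h by (auto simp: l_def t_def max_def field_simps)
  have l: "l0 \<le> l" "1 \<le> l" using s by (auto simp: l_def)
  define P where "P = complex_of_real (1 / m) \<cdot>\<^sub>m (complex_of_real m \<cdot>\<^sub>m \<rho>' - \<sigma>')"
  define Q where "Q = (complex_of_real l0 \<cdot>\<^sub>m \<sigma>' - \<rho>') + complex_of_real (l - l0) \<cdot>\<^sub>m \<sigma>'"
  have Pij: "P $$ (i, j) = \<rho>' $$ (i, j) - complex_of_real (1 / m) * \<sigma>' $$ (i, j)"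
    and Qij: "Q $$ (i, j) = complex_of_real l * \<sigma>' $$ (i, j) - \<rho>' $$ (i, j)" if "i < d'" "j < d'" for i j
    using that carr s(3) by (auto simp: P_def Q_def field_simps)
  have P: "psd d' P"
    unfolding P_def using s(3,6) by (intro psd_smult) (auto simp: loewner_le_def)
  have Q: "Q \<in> Defs.cone F'"
    unfolding Q_def using s(1,5) l by (intro cone_add[OF F'] cone_scale_memI) auto
  \<comment> \<open>The target cancels, leaving a multiple of a free state.\<close>
  have "P + Q = complex_of_real (l - 1 / m) \<cdot>\<^sub>m \<sigma>'"
  proof (rule eq_matI)
    fix i j assume "i < dim_row (complex_of_real (l - 1 / m) \<cdot>\<^sub>m \<sigma>')" "j < dim_col (complex_of_real (l - 1 / m) \<cdot>\<^sub>m \<sigma>')"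
    then have ij: "i < d'" "j < d'" using carr by auto
    then have "(P + Q) $$ (i, j) = P $$ (i, j) + Q $$ (i, j)"
      using carr by (simp add: Q_def)
    then show "(P + Q) $$ (i, j) = (complex_of_real (l - 1 / m) \<cdot>\<^sub>m \<sigma>') $$ (i, j)"
      using ij carr by (simp add: Pij Qij algebra_simps)
  qed (use carr in \<open>auto simp: Q_def\<close>)
  moreover have "1 / m \<le> l" using s(3) l(2) by (simp add: field_simps mult_ge1_I order_trans[of 1 l])
  ultimately have PQ: "P + Q \<in> Defs.cone F'"
    using cone_scale_memI[OF s(1), of "l - 1 / m"] by simp
  define k where "k = l - t / m"
  have k0: "0 \<le> k" using lm(1) s(3) by (simp add: k_def field_simps)
  have "k \<le> l * m - t"
  proof -
    have "k * 1 \<le> k * m" using k0 s(3) by (intro mult_left_mono) auto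
    then show ?thesis using s(3) by (simp add: k_def algebra_simps)
  qed
  then have k: "k < 2 * h" using lm(2) by (simp add: t_def)
  have "2 * k / (t - 1) < e"
  proof -
    have "2 * k < e * (w - 1) / 4" using k h(3) by simp
    also have "\<dots> \<le> e * ((w - 1) / 2)" using e w by (simp add: field_simps)
    also have "\<dots> \<le> e * (t - 1)" using t(2) e by (intro mult_left_mono) auto
    finally show ?thesis using t(1) by (simp add: pos_divide_less_eq)
  qed
  moreover have "ereal t < OmegaF d F \<rho>" using w h by (simp add: t_def)
  moreover have "complex_of_real t * P $$ (i, j) + Q $$ (i, j)
      = complex_of_real (t - 1) * \<rho>' $$ (i, j) + complex_of_real k * \<sigma>' $$ (i, j)" if "i < d'" "j < d'" for i j
    unfolding Pij[OF that] Qij[OF that] k_def using s(3) by (simp add: field_simps)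
  ultimately show ?thesis
    using approximable_by_mixture[OF F F' \<rho> \<rho>' t(1) _ P Q PQ k0 s(1)] by blast
qed

text \<open>Here the target is itself a limit of free states:
  \<open>l \<sigma>' - \<rho>' = (l - 1) \<tau>\<close> with \<open>l\<close> near 1 makes
  \<open>\<sigma>' - \<rho>'\<close> equal to \<open>(l - 1) (\<tau> - \<sigma>')\<close>. Preparing
  \<open>\<sigma>'\<close> whatever the input covers the case in which \<open>t - 1\<close> has no
  room to be positive.\<close>

lemma approximable_constant:
  assumes F: "free_set d F" and F': "free_set d' F'" and \<rho>: "density d \<rho>" and \<rho>': "density d' \<rho>'"
    and w: "OmegaFF d' F' \<rho>' \<le> 1" and e: "0 < e"
  shows "approximable d F d' F' \<rho> \<rho>' e"
proof -
  have "OmegaFF d' F' \<rho>' < ereal (1 + e / 2)"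
    using w e by (rule_tac order.strict_trans1) (auto simp: one_ereal_def)
  then obtain \<sigma>' l m where s: "\<sigma>' \<in> F'" "1 \<le> l" "1 \<le> m" "l * m < 1 + e / 2"
    "complex_of_real l \<cdot>\<^sub>m \<sigma>' - \<rho>' \<in> Defs.cone F'"
    by (rule OmegaFF_less_obtain[OF F' \<rho>'])
  have "l * 1 \<le> l * m" using s by (intro mult_left_mono) auto
  then have l: "l < 1 + e / 2" using s(4) by simp
  note d\<sigma>' = free_set_density[OF F' s(1)]
  note carr = density_carrier[OF \<rho>'] density_carrier[OF d\<sigma>']
  obtain k \<tau> where k: "\<tau> \<in> F'" "complex_of_real l \<cdot>\<^sub>m \<sigma>' - \<rho>' = complex_of_real k \<cdot>\<^sub>m \<tau>"
    using s(5) by (auto simp: Defs.cone_def)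
  note d\<tau> = free_set_density[OF F' k(1)]
  have entry: "complex_of_real l * \<sigma>' $$ (i, j) - \<rho>' $$ (i, j) = complex_of_real k * \<tau> $$ (i, j)"
    if "i < d'" "j < d'" for i j
    using arg_cong[OF k(2), of "\<lambda>X. X $$ (i, j)"] that carr density_carrier[OF d\<tau>] by simp
  have kl: "k = l - 1"
  proof -
    have "(\<Sum>i<d'. Re (complex_of_real l * \<sigma>' $$ (i, i) - \<rho>' $$ (i, i))) = (\<Sum>i<d'. Re (complex_of_real k * \<tau> $$ (i, i)))"
      by (intro sum.cong refl) (simp only: entry lessThan_iff)
    then show ?thesis
      using density_trace_sum[OF \<rho>'] density_trace_sum[OF d\<sigma>'] density_trace_sum[OF d\<tau>]
      by (simp add: sum_subtractf flip: sum_distrib_left)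
  qed
  \<comment> \<open>Pairing with the identity gives the trace, so every density operator is sent to
    twice \<open>\<sigma>'\<close>.\<close>
  let ?M = "measure_prepare d (1\<^sub>m d) (1\<^sub>m d) \<sigma>' \<sigma>'"
  have M: "?M X = 2 \<cdot>\<^sub>m \<sigma>'" if "density d X" for X
    using that density_carrier[OF that] carr unfolding measure_prepare_def
    by (intro eq_matI) (auto simp: trace_prod_one density_def)
  have tr: "mtrace (2 \<cdot>\<^sub>m \<sigma>') = 2"
    using mtrace_smult[OF carr(2)] d\<sigma>' by (simp add: density_def)
  have "cmod (\<sigma>' $$ (i, j) - \<rho>' $$ (i, j)) < e" if "i < d'" "j < d'" for i j
  proof -
    have "\<sigma>' $$ (i, j) - \<rho>' $$ (i, j) = complex_of_real (l - 1) * (\<tau> $$ (i, j) - \<sigma>' $$ (i, j))"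
      using entry[OF that] by (simp add: kl algebra_simps)
    then have "cmod (\<sigma>' $$ (i, j) - \<rho>' $$ (i, j)) = (l - 1) * cmod (\<tau> $$ (i, j) - \<sigma>' $$ (i, j))"
      using s(2) by (simp only: norm_mult norm_of_real)
    also have "\<dots> \<le> (l - 1) * 2"
      using s(2) norm_triangle_ineq4[of "\<tau> $$ (i, j)" "\<sigma>' $$ (i, j)"]
        density_entry_le_1[OF d\<tau> that] density_entry_le_1[OF d\<sigma>' that]
      by (intro mult_left_mono) auto
    also have "\<dots> < e" using l by simp
    finally show ?thesis .
  qed
  then have "\<forall>i<d'. \<forall>j<d'. cmod (?M \<rho> $$ (i, j) / mtrace (?M \<rho>) - \<rho>' $$ (i, j)) < e"
    using carr by (simp add: M[OF \<rho>] tr)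
  moreover have "0 < Re (mtrace (?M \<rho>))" by (simp add: M[OF \<rho>] tr)
  moreover have "?M \<sigma> \<in> Defs.cone F'" if "\<sigma> \<in> F" for \<sigma>
    using M[OF free_set_density[OF F that]] cone_scale_memI[OF s(1), of 2] by simp
  moreover have "psd d' \<sigma>'" using d\<sigma>' by (simp add: density_def)
  ultimately show ?thesis unfolding approximable_def using psd_one by blast
qed

text \<open>With \<open>P = \<rho>'\<close> and \<open>Q = l \<sigma>' - \<rho>'\<close> the free
  state has the fixed weight \<open>l\<close>, while the weight \<open>t - 1\<close> of the target
  may be as large as desired. Positivity of \<open>P\<close> comes for free, so no bound of
  \<open>\<sigma>'\<close> by \<open>\<rho>'\<close> enters.\<close>

lemma approximable_infinite_Omega:
  assumes F: "free_set d F" and F': "free_set d' F'" and \<rho>: "density d \<rho>" and \<rho>': "density d' \<rho>'"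
    and w: "OmegaF d F \<rho> = \<infinity>" "RFF d' F' \<rho>' < \<infinity>" and e: "0 < e"
  shows "approximable d F d' F' \<rho> \<rho>' e"
proof -
  obtain \<sigma>' where s: "\<sigma>' \<in> F'" "RmaxF d' F' \<rho>' \<sigma>' < \<infinity>"
    using w(2) unfolding RFF_def INF_less_iff by blast
  note d\<sigma>' = free_set_density[OF F' s(1)]
  note carr = density_carrier[OF \<rho>'] density_carrier[OF d\<sigma>']
  obtain l where l: "free_le d' F' \<rho>' (complex_of_real l \<cdot>\<^sub>m \<sigma>')"
    using RmaxF_less_obtain[OF s(2)] by blast
  have l1: "1 \<le> l" using free_le_density_ge_1[OF F' \<rho>' d\<sigma>' l] .
  define Q where "Q = complex_of_real l \<cdot>\<^sub>m \<sigma>' - \<rho>'"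
  \<comment> \<open>Chosen so that \<open>e * (t - 1) = e + 2 * l\<close>, which exceeds
    \<open>2 * l\<close>.\<close>
  define t where "t = 2 + 2 * l / e"
  have "0 < 2 * l / e" using l1 e by simp
  then have t: "1 < t" by (simp add: t_def)
  have "\<rho>' + Q = complex_of_real l \<cdot>\<^sub>m \<sigma>'"
    unfolding Q_def using carr by (intro eq_matI) auto
  then have PQ: "\<rho>' + Q \<in> Defs.cone F'" using cone_scale_memI[OF s(1)] l1 by simp
  have Q: "Q \<in> Defs.cone F'" using l by (simp add: free_le_def Q_def)
  have "2 * l < e * (t - 1)" using e by (simp add: t_def field_simps)
  then have "2 * l / (t - 1) < e" using t by (simp add: pos_divide_less_eq)
  moreover have "complex_of_real t * \<rho>' $$ (i, j) + Q $$ (i, j)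
      = complex_of_real (t - 1) * \<rho>' $$ (i, j) + complex_of_real l * \<sigma>' $$ (i, j)" if "i < d'" "j < d'" for i j
    using that carr by (simp add: Q_def algebra_simps)
  moreover have "psd d' \<rho>'" using \<rho>' by (simp add: density_def)
  moreover have "ereal t < OmegaF d F \<rho>" using w by simp
  ultimately show ?thesis
    using approximable_by_mixture[OF F F' \<rho> \<rho>' t _ _ Q PQ _ s(1), of l e] l1 by simp
qed

text \<open>The measured effect is the rank-one matrix of the vector \<open>v\<close> that all free
  states annihilate. Using it for both outcomes, with the target prepared each time, merely doubles
  the output, and the target is reached exactly.\<close>

lemma approximable_infinite_RF:
  assumes F: "free_set d F" and F': "free_set d' F'" and \<rho>: "density d \<rho>" and \<rho>': "density d' \<rho>'"
    and inf: "RF d F \<rho> = \<infinity>" and e: "0 < e"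
  shows "approximable d F d' F' \<rho> \<rho>' e"
proof -
  obtain v where v: "\<And>\<sigma>. \<sigma> \<in> F \<Longrightarrow> Re (bform d (($$) \<sigma>) v v) = 0" "0 < Re (bform d (($$) \<rho>) v v)"
    using RF_infinite_null_vector[OF F \<rho> inf] by blast
  define A where "A = mat d d (\<lambda>(i, j). v i * cnj (v j))"
  have A: "psd d A"
    using psdf_rank_one[of d v] psdf_cong[of d "($$) A" "\<lambda>(i, j). v i * cnj (v j)"]
    by (simp add: psd_iff_psdf A_def)
  have trA: "trace_prod d A X = complex_of_real (Re (bform d (($$) X) v v))" if "density d X" for X
  proof -
    have "trace_prod d A X = bform d (($$) X) v v"
      unfolding trace_prod_def bform_def by (intro sum.cong refl) (simp add: A_def algebra_simps)
    then show ?thesis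
      using bform_self_real[of d "($$) X" v] that by (simp add: density_def psd_iff_psdf)
  qed
  define c where "c = Re (bform d (($$) \<rho>) v v)"
  have c: "0 < c" using v(2) by (simp add: c_def)
  note carr = density_carrier[OF \<rho>']
  let ?M = "measure_prepare d A A \<rho>' \<rho>'"
  have M: "?M \<rho> = complex_of_real (2 * c) \<cdot>\<^sub>m \<rho>'"
    unfolding measure_prepare_def trA[OF \<rho>] c_def[symmetric] using carr by (intro eq_matI) auto
  have tr: "mtrace (?M \<rho>) = complex_of_real (2 * c)"
    unfolding M mtrace_smult[OF carr] using \<rho>' by (simp add: density_def)
  have "?M \<sigma> \<in> Defs.cone F'" if \<sigma>: "\<sigma> \<in> F" for \<sigma>
  proof -
    obtain \<tau> where \<tau>: "\<tau> \<in> F'" using F' by (auto simp: free_set_def)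
    \<comment> \<open>The zero output counts as a free state with weight 0.\<close>
    have "?M \<sigma> = complex_of_real 0 \<cdot>\<^sub>m \<tau>"
      unfolding measure_prepare_def trA[OF free_set_density[OF F \<sigma>]] v(1)[OF \<sigma>]
      using carr density_carrier[OF free_set_density[OF F' \<tau>]] by (intro eq_matI) auto
    then show ?thesis using cone_scale_memI[OF \<tau>, of 0] by simp
  qed
  moreover have "cmod (?M \<rho> $$ (i, j) / mtrace (?M \<rho>) - \<rho>' $$ (i, j)) < e" if "i < d'" "j < d'" for i j
    unfolding tr unfolding M using carr that c e by simp
  moreover have "0 < Re (mtrace (?M \<rho>))" using c by (simp add: tr)
  moreover have "psd d' \<rho>'" using \<rho>' by (simp add: density_def)
  ultimately show ?thesis unfolding approximable_def using A by blast
qed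

theorem theorem4:
  fixes d d' :: nat and F F' :: "complex mat set" and \<rho> \<rho>' :: "complex mat"
  assumes "free_set d F" and "free_set d' F'"
    and "density d \<rho>" and "density d' \<rho>'"
    and "(OmegaF d F \<rho> < \<infinity> \<and> OmegaF d F \<rho> \<ge> OmegaFF d' F' \<rho>')
         \<or> (OmegaF d F \<rho> = \<infinity> \<and> RFF d' F' \<rho>' < \<infinity>)
         \<or> RF d F \<rho> = \<infinity>"
  shows "prob_transformable d F d' F' \<rho> \<rho>'"
proof (rule prob_transformableI[OF assms(1,2)])
  fix e :: real assume e: "0 < e"
  note hyps = assms(1-4)
  show "approximable d F d' F' \<rho> \<rho>' e"
    using assms(5)
  proof (elim disjE conjE)
    assume w: "OmegaF d F \<rho> < \<infinity>" "OmegaF d F \<rho> \<ge> OmegaFF d' F' \<rho>'"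
    show ?thesis
    \<comment> \<open>If the input value is at most 1, the hypothesis bounds that of the target by 1
      as well and a constant preparation suffices; otherwise it is a real number above 1 and leaves
      room for \<open>t\<close> between 1 and it.\<close>
    proof (cases "OmegaF d F \<rho> \<le> 1")
      case True
      then show ?thesis using approximable_constant[OF hyps _ e] w(2) by (meson order_trans)
    next
      case False
      then obtain r where "OmegaF d F \<rho> = ereal r" "1 < r"
        using w(1) by (cases "OmegaF d F \<rho>") (auto simp: one_ereal_def)
      then show ?thesis using approximable_finite_Omega[OF hyps _ _ _ e] w(2) by simp
    qed
  next
    assume "OmegaF d F \<rho> = \<infinity>" "RFF d' F' \<rho>' < \<infinity>"
    then show ?thesis using approximable_infinite_Omega[OF hyps _ _ e] by simp
  next
    assume "RF d F \<rho> = \<infinity>"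
    then show ?thesis using approximable_infinite_RF[OF hyps _ e] by simp
  qed
qed

end
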